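(* Let $K$ be a finite simplicial complex with a position function $v:K_0\to\mathbb{R}^d$, let $F:\mathcal{D}\to\mathcal{B}$ be a feature map into a separable real Banach space with a labeled decomposition $\hat F:\hat{\mathcal{D}}_K\to\mathcal{B}^{S(K)}$, and let $\alpha:\mathbb{R}^m\to\mathcal{D}$, $\hat\alpha:\mathbb{R}^m\to\hat{\mathcal{D}}_K$, $\eta_K=\bar F\circ\hat\alpha:\mathbb{R}^m\to\mathcal{B}^K$ and $\eta_{\mathcal{C}}=\tilde F\circ\hat\alpha:\mathbb{R}^m\to\mathcal{B}^{\mathcal{C}}$ be the maps defined in the context. Let $X:(\Omega,\mathcal{F},P)\to\mathbb{R}^m$ be a Borel random variable on a probability space. Assume that $E(F(\alpha(X)))$ exists. Then $$E(F(\alpha(X)))=\sum_{K}E(\eta_K(X))=\sum_{\mathcal{C}}E(\eta_{\mathcal{C}}(X)),$$ where $\sum_K$ and $\sum_{\mathcal{C}}$ denote the sum of the coordinates, indexed by $\sigma\in K$ and by $c\in\mathcal{C}$ respectively.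
   Context: Chains. $K$ is a finite abstract simplicial complex: a collection of nonempty subsets of a finite set, closed under taking nonempty subsets and containing all singletons; $K_i$ is the set of simplices of cardinality $i+1$. $S(K)$ is the $\mathbb{Z}/2$-vector space with basis $K$; its elements (chains) are identified with subsets of $K$, and $\|\gamma\|_1$ is the number of simplices in $\gamma$. Persistence. For a total order $\le$ on $K$ extending inclusion $\subseteq$ (a linear extension), the boundary matrix $D$ over $\mathbb{Z}/2$ has rows and columns indexed by $K$ in the order $\le$, with $D_{\sigma\tau}=1$ iff $\sigma\subset\tau$ and $|\sigma|=|\tau|-1$ (cardinalities). A matrix $R$ is reduced if distinct nonzero columns have different largest row indices of nonzero entries. A persistence algorithm $\mathcal{A}$ assigns to each boundary matrix $D$ a decomposition $R=DV$ with $R$ reduced and $V$ upper triangular with ones on the diagonal. A birth-death pair is a pair $(\sigma,\tau)$ such that $\sigma$ is the largest row index of a nonzero entry in column $\tau$ of $R$. Each birth-death pair has four associated chains: the birth simplex $\sigma$, the death simplex $\tau$, the representative cycle (sum of all $\rho$ with $R_{\rho\tau}\ne0$) and the bounding chain (sum of all $\rho$ with $V_{\rho\tau}\neq0$). Fix one of these four kinds of chain as the label of birth-death pairs. Diagrams. $\mathcal{D}$ is the set of persistence diagrams, i.e. finite formal sums (multisets) $\sum_i(b_i,d_i)$ with $b_i\le d_i$ real. A labeled persistence diagram is a finite formal sum $\sum_i(b_i,d_i,\ell_i)$ with $b_i\le d_i$; $\hat{\mathcal{D}}_K$ is the set of those arising from $K$, including the empty one $0$, with labels in $S(K)$. $\varphi$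 is the map forgetting labels. Weights. A weight on $K$ is a function $w:K\to\mathbb{R}$ with $w(\sigma)\le w(\tau)$ whenever $\sigma\subseteq\tau$; $W\subseteq\mathbb{R}^K$ is the set of weights. For $w\in W$, $\alpha(w)=\sum(w(\sigma),w(\tau))$, summed over birth-death pairs computed with any linear extension for which $w$ is order-preserving (this is independent of choices). Fix a persistence algorithm $\mathcal{A}$ and a linear extension $\trianglelefteq$ of $\subseteq$. Order $K$ by: $\sigma\le_w\tau$ iff $w(\sigma)<w(\tau)$, or $w(\sigma)=w(\tau)$ and $\sigma\trianglelefteq\tau$. Then $\hat\alpha(w)=\sum(w(\sigma),w(\tau),\gamma)$, summed over birth-death pairs $(\sigma,\tau)$ obtained by applying $\mathcal{A}$ to $(K,\le_w)$, where $\gamma$ is the label of the pair. Fix $A\subseteq\mathbb{R}^m$ and $\psi:A\to W$; define $\alpha:\mathbb{R}^m\to\mathcal{D}$ and $\hat\alpha:\mathbb{R}^m\to\hat{\mathcal{D}}_K$ by $\alpha(p)=\alpha(\psi(p))$, $\hat\alpha(p)=\hat\alpha(\psi(p))$ for $p\in A$, and the value $0$ (empty diagram) for $p\notin A$. Feature maps. $\mathcal{B}$ is a separable real Banach space; for a finite set $S$, $\mathcal{B}^S$ has norm $\|x\|=\sum_{s\in S}\|x_s\|$. A feature map is a function $F:\mathcal{D}\to\mathcal{B}$. A labeled decomposition of $F$ is a map $\hat F=(\hat F_\gamma)_{\gamma\in S(K)}:\hat{\mathcal{D}}_K\to\mathcal{B}^{S(K)}$ with $\sum_{\gamma\in S(K)}\hat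 F_\gamma(\hat a)=F(\varphi(\hat a))$ for all $\hat a\in\hat{\mathcal{D}}_K$. The simplex distribution is $\bar F:\hat{\mathcal{D}}_K\to\mathcal{B}^K$, $\bar F_\sigma(\hat a)=\sum_{\gamma\ni\sigma}\hat F_\gamma(\hat a)/\|\gamma\|_1$ (sum over chains containing $\sigma$). For the position function $v:K_0\to\mathbb{R}^d$ ($d\ge1$), $|\sigma|$ is the convex hull of $v(\sigma)$ and $d_\sigma$ is the dimension of $|\sigma|$. Given a partition of $\mathbb{R}^d$ into translates of a half-open cube $[0,s)^d$ ($s>0$), $\mathcal{C}$ is the finite set of translates that meet $\bigcup_{\sigma\in K}|\sigma|$. The pixel/voxel distribution is $\tilde F:\hat{\mathcal{D}}_K\to\mathcal{B}^{\mathcal{C}}$, $\tilde F_c(\hat a)=\sum_{\sigma\in K}\frac{\operatorname{vol}_{d_\sigma}(|\sigma|\cap c)}{\operatorname{vol}_{d_\sigma}(|\sigma|)}\bar F_\sigma(\hat a)$, where $\operatorname{vol}_k$ is $k$-dimensional volume. The maps $\eta_K$ and $\eta_{\mathcal{C}}$ are taken to be Borel measurable. Expectations of Banach-space-valued random variables are Pettis integrals.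
   Formalization: The component of the labeled decomposition at the zero chain is assumed to vanish, and each equality is stated assuming that the expectation E(η_K(X)), respectively E(η_C(X)), in it exists (existence of the former is shown to imply that of the latter). *)

theory Defs
  imports "HOL-Probability.Probability" "HOL-Library.Z2"
begin

section \<open>Simplicial complexes and chains\<close>

definition finite_simplicial_complex :: "'v set \<Rightarrow> 'v set set \<Rightarrow> bool" where
  "finite_simplicial_complex V K \<longleftrightarrow>
     finite V \<and> (\<forall>\<sigma>\<in>K. \<sigma> \<noteq> {} \<and> \<sigma> \<subseteq> V) \<and>
     (\<forall>\<sigma>\<in>K. \<forall>\<tau>. \<tau> \<subseteq> \<sigma> \<and> \<tau> \<noteq> {} \<longrightarrow> \<tau> \<in> K) \<and>
     (\<forall>x\<in>V. {x} \<in> K)"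

text \<open>Chains with coefficients in the field with two elements are identified with their supports;
  the empty set is the zero chain, and the 1-norm of a chain is its cardinality.\<close>

type_synonym 'v chain = "'v set set"

definition chains :: "'v set set \<Rightarrow> 'v chain set" where
  "chains K = Pow K"

section \<open>Persistence\<close>

text \<open>Matrices are indexed by simplices; only the entries with both indices in \<open>K\<close> matter.
  Since rows and columns carry the simplices as names, the boundary matrix is the same function for
  every linear extension; the ordering of rows and columns is the separate datum \<open>le\<close>,
  a relation with \<open>(\<sigma>, \<tau>) \<in> le\<close> meaning that \<open>\<sigma>\<close> comes before or equals \<open>\<tau>\<close>.\<close>

type_synonym 'v matrix = "'v set \<Rightarrow> 'v set \<Rightarrow> bit"

definition linear_extension :: "'v set set \<Rightarrow> 'v set rel \<Rightarrow> bool" where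
  "linear_extension K le \<longleftrightarrow>
     linear_order_on K le \<and> (\<forall>\<sigma>\<in>K. \<forall>\<tau>\<in>K. \<sigma> \<subseteq> \<tau> \<longrightarrow> (\<sigma>, \<tau>) \<in> le)"

definition boundary_matrix :: "'v matrix" where
  "boundary_matrix \<sigma> \<tau> = (if \<sigma> \<subset> \<tau> \<and> card \<tau> = Suc (card \<sigma>) then 1 else 0)"

definition is_low :: "'v set set \<Rightarrow> 'v set rel \<Rightarrow> 'v matrix \<Rightarrow> 'v set \<Rightarrow> 'v set \<Rightarrow> bool" where
  "is_low K le R \<sigma> \<tau> \<longleftrightarrow>
     \<sigma> \<in> K \<and> \<tau> \<in> K \<and> R \<sigma> \<tau> \<noteq> 0 \<and> (\<forall>\<rho>\<in>K. R \<rho> \<tau> \<noteq> 0 \<longrightarrow> (\<rho>, \<sigma>) \<in> le)"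

definition reduced :: "'v set set \<Rightarrow> 'v set rel \<Rightarrow> 'v matrix \<Rightarrow> bool" where
  "reduced K le R \<longleftrightarrow>
     (\<forall>\<tau>\<in>K. \<forall>\<tau>'\<in>K. \<forall>\<sigma> \<sigma>'. \<tau> \<noteq> \<tau>' \<and> is_low K le R \<sigma> \<tau> \<and> is_low K le R \<sigma>' \<tau>' \<longrightarrow> \<sigma> \<noteq> \<sigma>')"

definition unit_upper_triangular :: "'v set set \<Rightarrow> 'v set rel \<Rightarrow> 'v matrix \<Rightarrow> bool" where
  "unit_upper_triangular K le U \<longleftrightarrow>
     (\<forall>\<tau>\<in>K. U \<tau> \<tau> = 1) \<and> (\<forall>\<rho>\<in>K. \<forall>\<tau>\<in>K. U \<rho> \<tau> \<noteq> 0 \<longrightarrow> (\<rho>, \<tau>) \<in> le)"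

definition persistence_decomposition ::
    "'v set set \<Rightarrow> 'v set rel \<Rightarrow> 'v matrix \<Rightarrow> 'v matrix \<Rightarrow> bool" where
  "persistence_decomposition K le R U \<longleftrightarrow>
     (\<forall>\<sigma>\<in>K. \<forall>\<tau>\<in>K. R \<sigma> \<tau> = (\<Sum>\<rho>\<in>K. boundary_matrix \<sigma> \<rho> * U \<rho> \<tau>)) \<and>
     reduced K le R \<and> unit_upper_triangular K le U"

text \<open>An algorithm maps the ordered boundary matrix, that is, the ordering of \<open>K\<close>,
  to the pair \<open>(R, U)\<close> with \<open>R = D U\<close>.\<close>

definition persistence_algorithm ::
    "'v set set \<Rightarrow> ('v set rel \<Rightarrow> 'v matrix \<times> 'v matrix) \<Rightarrow> bool" where
  "persistence_algorithm K alg \<longleftrightarrow>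
     (\<forall>le. linear_extension K le \<longrightarrow>
        persistence_decomposition K le (fst (alg le)) (snd (alg le)))"

definition birth_death_pairs ::
    "'v set set \<Rightarrow> 'v set rel \<Rightarrow> 'v matrix \<Rightarrow> ('v set \<times> 'v set) set" where
  "birth_death_pairs K le R = {(\<sigma>, \<tau>). is_low K le R \<sigma> \<tau>}"

datatype label_kind = Birth_Simplex | Death_Simplex | Representative_Cycle | Bounding_Chain

fun label :: "label_kind \<Rightarrow> 'v set set \<Rightarrow> 'v matrix \<Rightarrow> 'v matrix \<Rightarrow> 'v set \<times> 'v set \<Rightarrow> 'v chain" where
  "label Birth_Simplex K R U (\<sigma>, \<tau>) = {\<sigma>}"
| "label Death_Simplex K R U (\<sigma>, \<tau>) = {\<tau>}"
| "label Representative_Cycle K R U (\<sigma>, \<tau>) = {\<rho> \<in> K. R \<rho> \<tau> \<noteq> 0}"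
| "label Bounding_Chain K R U (\<sigma>, \<tau>) = {\<rho> \<in> K. U \<rho> \<tau> \<noteq> 0}"

section \<open>Diagrams of weights\<close>

type_synonym diagram = "(real \<times> real) multiset"
type_synonym 'v labeled_diagram = "(real \<times> real \<times> 'v chain) multiset"

definition forget_labels :: "'v labeled_diagram \<Rightarrow> diagram" where
  "forget_labels a = image_mset (\<lambda>(b, d, l). (b, d)) a"

definition weights :: "'v set set \<Rightarrow> ('v set \<Rightarrow> real) set" where
  "weights K = {w. \<forall>\<sigma>\<in>K. \<forall>\<tau>\<in>K. \<sigma> \<subseteq> \<tau> \<longrightarrow> w \<sigma> \<le> w \<tau>}"

definition order_preserving :: "'v set rel \<Rightarrow> ('v set \<Rightarrow> real) \<Rightarrow> bool" where
  "order_preserving le w \<longleftrightarrow> (\<forall>(\<sigma>, \<tau>)\<in>le. w \<sigma> \<le> w \<tau>)"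

text \<open>The diagram of a weight does not depend on the linear extension nor on the decomposition, so an
  arbitrary choice is made.\<close>

definition weight_diagram :: "'v set set \<Rightarrow> ('v set \<Rightarrow> real) \<Rightarrow> diagram" where
  "weight_diagram K w =
     (SOME a. \<exists>le R U. linear_extension K le \<and> order_preserving le w \<and>
        persistence_decomposition K le R U \<and>
        a = image_mset (\<lambda>(\<sigma>, \<tau>). (w \<sigma>, w \<tau>)) (mset_set (birth_death_pairs K le R)))"

definition weight_order ::
    "'v set set \<Rightarrow> 'v set rel \<Rightarrow> ('v set \<Rightarrow> real) \<Rightarrow> 'v set rel" where
  "weight_order K tri w =
     {(\<sigma>, \<tau>) \<in> K \<times> K. w \<sigma> < w \<tau> \<or> w \<sigma> = w \<tau> \<and> (\<sigma>, \<tau>) \<in> tri}"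

definition labeled_weight_diagram ::
    "'v set set \<Rightarrow> ('v set rel \<Rightarrow> 'v matrix \<times> 'v matrix) \<Rightarrow> 'v set rel \<Rightarrow> label_kind \<Rightarrow>
     ('v set \<Rightarrow> real) \<Rightarrow> 'v labeled_diagram" where
  "labeled_weight_diagram K alg tri kind w =
     (let le = weight_order K tri w; R = fst (alg le); U = snd (alg le) in
        image_mset (\<lambda>(\<sigma>, \<tau>). (w \<sigma>, w \<tau>, label kind K R U (\<sigma>, \<tau>)))
          (mset_set (birth_death_pairs K le R)))"

text \<open>The labeled diagrams arising from \<open>K\<close>, for the fixed algorithm, linear extension and kind
  of label. Being the smallest possible reading of this set, it makes the requirement on a labeled
  decomposition below the least restrictive.\<close>

definition labeled_diagrams ::
    "'v set set \<Rightarrow> ('v set rel \<Rightarrow> 'v matrix \<times> 'v matrix) \<Rightarrow> 'v set rel \<Rightarrow> label_kind \<Rightarrow>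
     'v labeled_diagram set" where
  "labeled_diagrams K alg tri kind =
     insert {#} (labeled_weight_diagram K alg tri kind ` weights K)"

definition param_diagram ::
    "'v set set \<Rightarrow> 'p set \<Rightarrow> ('p \<Rightarrow> 'v set \<Rightarrow> real) \<Rightarrow> 'p \<Rightarrow> diagram" where
  "param_diagram K A \<psi> p = (if p \<in> A then weight_diagram K (\<psi> p) else {#})"

definition param_labeled_diagram ::
    "'v set set \<Rightarrow> ('v set rel \<Rightarrow> 'v matrix \<times> 'v matrix) \<Rightarrow> 'v set rel \<Rightarrow> label_kind \<Rightarrow>
     'p set \<Rightarrow> ('p \<Rightarrow> 'v set \<Rightarrow> real) \<Rightarrow> 'p \<Rightarrow> 'v labeled_diagram" where
  "param_labeled_diagram K alg tri kind A \<psi> p =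
     (if p \<in> A then labeled_weight_diagram K alg tri kind (\<psi> p) else {#})"

section \<open>Feature maps and their distributions\<close>

text \<open>A feature map is a function on all multisets of pairs of reals; its values at multisets that
  contain a pair \<open>(b, d)\<close> with \<open>b > d\<close> play no role.\<close>

definition labeled_decomposition ::
    "'v set set \<Rightarrow> 'v labeled_diagram set \<Rightarrow> (diagram \<Rightarrow> 'b::real_normed_vector) \<Rightarrow>
     ('v chain \<Rightarrow> 'v labeled_diagram \<Rightarrow> 'b) \<Rightarrow> bool" where
  "labeled_decomposition K Dhat F Fhat \<longleftrightarrow>
     (\<forall>a\<in>Dhat. (\<Sum>\<gamma>\<in>chains K. Fhat \<gamma> a) = F (forget_labels a))"

text \<open>The component of the zero chain enters no coordinate of the simplex distribution, since the zero
  chain contains no simplex. The coordinates therefore add up to the feature map only if that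
  component vanishes.\<close>

definition simplex_distribution ::
    "'v set set \<Rightarrow> ('v chain \<Rightarrow> 'v labeled_diagram \<Rightarrow> 'b::real_normed_vector) \<Rightarrow>
     'v labeled_diagram \<Rightarrow> 'v set \<Rightarrow> 'b" where
  "simplex_distribution K Fhat a =
     (\<lambda>\<sigma>\<in>K. \<Sum>\<gamma> | \<gamma> \<in> chains K \<and> \<sigma> \<in> \<gamma>. Fhat \<gamma> a /\<^sub>R real (card \<gamma>))"

definition realization :: "('v \<Rightarrow> 'a::euclidean_space) \<Rightarrow> 'v set \<Rightarrow> 'a set" where
  "realization v \<sigma> = convex hull (v ` \<sigma>)"

text \<open>Lebesgue measure of dimension \<open>aff_dim H\<close> on a nonempty affine subspace \<open>H\<close>, as a Borel measure
  on the ambient space: the product Lebesgue measure on coordinates with respect to an orthonormal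
  basis \<open>B\<close> of the direction space of \<open>H\<close>, transported along the isometry onto \<open>H\<close> with origin \<open>a\<close>.
  The result does not depend on \<open>a\<close> and \<open>B\<close>. If \<open>H\<close> is a point, it is the point mass.\<close>

definition flat_measure :: "'a::euclidean_space set \<Rightarrow> 'a measure" where
  "flat_measure H =
     (let a = (SOME a. a \<in> H);
          B = (SOME B. pairwise orthogonal B \<and> (\<forall>b\<in>B. norm b = 1) \<and> span B = (\<lambda>x. x - a) ` H)
      in distr (\<Pi>\<^sub>M b\<in>B. (lborel :: real measure)) borel (\<lambda>f. a + (\<Sum>b\<in>B. f b *\<^sub>R b)))"

text \<open>The volume of \<open>T \<subseteq> P\<close> in the dimension of the convex set \<open>P\<close>.\<close>

definition rel_volume :: "'a::euclidean_space set \<Rightarrow> 'a set \<Rightarrow> real" where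
  "rel_volume P T = measure (flat_measure (affine hull P)) T"

definition half_open_cube :: "real \<Rightarrow> (real ^ 'd) set" where
  "half_open_cube s = {x. \<forall>i. 0 \<le> x $ i \<and> x $ i < s}"

definition cube_partition :: "real \<Rightarrow> (real ^ 'd) set set \<Rightarrow> bool" where
  "cube_partition s Q \<longleftrightarrow>
     s > 0 \<and> partition_on UNIV Q \<and> (\<forall>c\<in>Q. \<exists>t. c = (\<lambda>x. t + x) ` half_open_cube s)"

definition voxels ::
    "'v set set \<Rightarrow> ('v \<Rightarrow> real ^ 'd) \<Rightarrow> (real ^ 'd) set set \<Rightarrow> (real ^ 'd) set set" where
  "voxels K v Q = {c \<in> Q. c \<inter> (\<Union>\<sigma>\<in>K. realization v \<sigma>) \<noteq> {}}"

definition voxel_distribution ::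
    "'v set set \<Rightarrow> ('v \<Rightarrow> real ^ 'd) \<Rightarrow> (real ^ 'd) set set \<Rightarrow>
     ('v chain \<Rightarrow> 'v labeled_diagram \<Rightarrow> 'b::real_normed_vector) \<Rightarrow>
     'v labeled_diagram \<Rightarrow> (real ^ 'd) set \<Rightarrow> 'b" where
  "voxel_distribution K v Q Fhat a =
     (\<lambda>c\<in>voxels K v Q. \<Sum>\<sigma>\<in>K.
        (rel_volume (realization v \<sigma>) (realization v \<sigma> \<inter> c) /
         rel_volume (realization v \<sigma>) (realization v \<sigma>)) *\<^sub>R simplex_distribution K Fhat a \<sigma>)"

section \<open>Pettis integrals\<close>

text \<open>The Pettis integral of \<open>f\<close> with values in a Banach space with underlying set \<open>E\<close> and
  continuous dual \<open>\<Phi>\<close>. Both are parameters because the notion is needed for the type \<open>'b\<close> and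
  for the finite powers of \<open>'b\<close>.\<close>

definition has_pettis_integral ::
    "'e set \<Rightarrow> ('e \<Rightarrow> real) set \<Rightarrow> 'w measure \<Rightarrow> ('w \<Rightarrow> 'e) \<Rightarrow> 'e \<Rightarrow> bool" where
  "has_pettis_integral E \<Phi> M f e \<longleftrightarrow>
     e \<in> E \<and> (\<forall>\<phi>\<in>\<Phi>. integrable M (\<lambda>\<omega>. \<phi> (f \<omega>)) \<and> (\<integral>\<omega>. \<phi> (f \<omega>) \<partial>M) = \<phi> e)"

definition dual_space :: "('b::real_normed_vector \<Rightarrow> real) set" where
  "dual_space = {\<phi>. bounded_linear \<phi>}"

text \<open>The power of \<open>'b\<close> with finite exponent \<open>S\<close>, normed by the sum of the norms of the coordinates,
  consists of the functions in \<open>S \<rightarrow>\<^sub>E UNIV\<close>. Its functionals are written as functionals on all functions;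
  the bound forces them to ignore the values outside \<open>S\<close>.\<close>

definition power_dual :: "'s set \<Rightarrow> (('s \<Rightarrow> 'b::real_normed_vector) \<Rightarrow> real) set" where
  "power_dual S =
     {\<phi>. (\<forall>x y. \<phi> (\<lambda>s. x s + y s) = \<phi> x + \<phi> y) \<and>
          (\<forall>r x. \<phi> (\<lambda>s. r *\<^sub>R x s) = r * \<phi> x) \<and>
          (\<exists>C. \<forall>x. \<bar>\<phi> x\<bar> \<le> C * (\<Sum>s\<in>S. norm (x s)))}"

definition pettis_expectation_exists :: "'w measure \<Rightarrow> ('w \<Rightarrow> 'b::real_normed_vector) \<Rightarrow> bool" where
  "pettis_expectation_exists M f \<longleftrightarrow> (\<exists>e. has_pettis_integral UNIV dual_space M f e)"

definition pettis_expectation :: "'w measure \<Rightarrow> ('w \<Rightarrow> 'b::real_normed_vector) \<Rightarrow> 'b" where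
  "pettis_expectation M f = (THE e. has_pettis_integral UNIV dual_space M f e)"

definition power_pettis_expectation_exists ::
    "'s set \<Rightarrow> 'w measure \<Rightarrow> ('w \<Rightarrow> 's \<Rightarrow> 'b::real_normed_vector) \<Rightarrow> bool" where
  "power_pettis_expectation_exists S M f \<longleftrightarrow>
     (\<exists>e. has_pettis_integral (S \<rightarrow>\<^sub>E UNIV) (power_dual S) M f e)"

definition power_pettis_expectation ::
    "'s set \<Rightarrow> 'w measure \<Rightarrow> ('w \<Rightarrow> 's \<Rightarrow> 'b::real_normed_vector) \<Rightarrow> 's \<Rightarrow> 'b" where
  "power_pettis_expectation S M f = (THE e. has_pettis_integral (S \<rightarrow>\<^sub>E UNIV) (power_dual S) M f e)"

end

(* The number of birth-death pairs with birth simplex in an up-set and death simplex in a down-set of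
   the order is the rank of the corresponding submatrix of the boundary matrix. Level sets of a weight
   are up- and down-sets for every compatible order, so the diagram does not depend on the order, and
   forgetting the labels of the labeled diagram gives the diagram. The coordinates of the simplex
   distribution then add up to the feature map by double counting, and so do those of the voxel
   distribution because the voxels cut every simplex into pieces whose relative volumes add up to 1.
   Expectations commute with bounded linear maps between powers of the Banach space; that the Pettis
   integral is unique is the theorem of Hahn and Banach. *)

theory Submission
  imports Defs "HOL-Library.Function_Algebras"
begin

section \<open>Counting birth-death pairs by ranks over the field with two elements\<close>

section \<open>Independence of the diagram of the linear extension\<close>

text \<open>Pointwise scaling turns functions into \<open>bit\<close> into a vector space, so that
  the span and dimension of a set of columns become the column space and rank of a matrix.\<close>

definition bit_scale :: "bit \<Rightarrow> ('x \<Rightarrow> bit) \<Rightarrow> 'x \<Rightarrow> bit" where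
  "bit_scale c f = (\<lambda>x. c * f x)"

interpretation bit_fun: vector_space bit_scale
  by unfold_locales (auto simp: bit_scale_def fun_eq_iff algebra_simps)

lemma fun_sum_apply: "(\<Sum>i\<in>I. f i) x = (\<Sum>i\<in>I. f i x)"
  for f :: "'i \<Rightarrow> 'x \<Rightarrow> 'a::comm_monoid_add"
  by (induction I rule: infinite_finite_induct) auto

lemma finite_complex: "finite_simplicial_complex V K \<Longrightarrow> finite K"
  unfolding finite_simplicial_complex_def by (meson Pow_iff finite_Pow_iff rev_finite_subset subsetI)

lemma linear_extensionD:
  assumes "linear_extension K le"
  shows "(\<sigma>, \<tau>) \<in> le \<Longrightarrow> \<sigma> \<in> K \<and> \<tau> \<in> K"
    and "\<sigma> \<in> K \<Longrightarrow> (\<sigma>, \<sigma>) \<in> le"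
    and "(\<rho>, \<sigma>) \<in> le \<Longrightarrow> (\<sigma>, \<tau>) \<in> le \<Longrightarrow> (\<rho>, \<tau>) \<in> le"
    and "(\<sigma>, \<tau>) \<in> le \<Longrightarrow> (\<tau>, \<sigma>) \<in> le \<Longrightarrow> \<sigma> = \<tau>"
    and "\<sigma> \<in> K \<Longrightarrow> \<tau> \<in> K \<Longrightarrow> (\<sigma>, \<tau>) \<in> le \<or> (\<tau>, \<sigma>) \<in> le"
proof -
  have "le \<subseteq> K \<times> K" "refl_on K le" "trans le" "antisym le" "total_on K le"
    using assms
    by (auto simp: linear_extension_def linear_order_on_def partial_order_on_def preorder_on_def)
  then show "(\<sigma>, \<tau>) \<in> le \<Longrightarrow> \<sigma> \<in> K \<and> \<tau> \<in> K"
    "\<sigma> \<in> K \<Longrightarrow> (\<sigma>, \<sigma>) \<in> le"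
    "(\<rho>, \<sigma>) \<in> le \<Longrightarrow> (\<sigma>, \<tau>) \<in> le \<Longrightarrow> (\<rho>, \<tau>) \<in> le"
    "(\<sigma>, \<tau>) \<in> le \<Longrightarrow> (\<tau>, \<sigma>) \<in> le \<Longrightarrow> \<sigma> = \<tau>"
    "\<sigma> \<in> K \<Longrightarrow> \<tau> \<in> K \<Longrightarrow> (\<sigma>, \<tau>) \<in> le \<or> (\<tau>, \<sigma>) \<in> le"
    unfolding refl_on_def total_on_def by (blast, blast, blast dest: transD, blast dest: antisymD, metis)
qed

lemma linear_extension_has_max:
  assumes "finite S" "S \<noteq> {}" "S \<subseteq> K" "linear_extension K le"
  obtains m where "m \<in> S" "\<And>x. x \<in> S \<Longrightarrow> (x, m) \<in> le"
proof -
  have "\<exists>m\<in>S. \<forall>x\<in>S. (x, m) \<in> le"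
    using assms(1-3)
  proof (induction S rule: finite_ne_induct)
    case (singleton x)
    then show ?case using linear_extensionD(2)[OF assms(4)] by auto
  next
    case (insert x S)
    then obtain m where m: "m \<in> S" "\<forall>x\<in>S. (x, m) \<in> le" by auto
    consider "(x, m) \<in> le" | "(m, x) \<in> le"
      using linear_extensionD(5)[OF assms(4), of x m] insert m by auto
    then show ?case
    proof cases
      case 1
      then show ?thesis using m by auto
    next
      case 2
      then have "\<forall>y\<in>insert x S. (y, x) \<in> le"
        using m linear_extensionD(2,3)[OF assms(4)] insert by (metis insert_iff insert_subset)
      then show ?thesis by blast
    qed
  qed
  then show thesis using that by blast
qed

text \<open>A column of the submatrix with rows \<open>Up\<close>, padded with zeros so that all
  columns live in the same function space whatever \<open>Up\<close> is.\<close>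

definition restricted_column :: "'v set set \<Rightarrow> 'v matrix \<Rightarrow> 'v set \<Rightarrow> 'v set \<Rightarrow> bit" where
  "restricted_column Up N \<tau> = (\<lambda>\<sigma>. if \<sigma> \<in> Up then N \<sigma> \<tau> else 0)"

text \<open>Since \<open>U\<close> is unit upper triangular, column \<tau> of \<open>R\<close> is
  column \<tau> of the boundary matrix plus some earlier columns. As \<open>Lo\<close> is closed
  under predecessors, these column operations never leave \<open>Lo\<close>, and they can be
  inverted one column at a time. Truncating the rows commutes with them.\<close>

lemma span_reduced_columns:
  assumes fin: "finite K" and le: "linear_extension K le"
    and dec: "persistence_decomposition K le R U"
    and Up: "Up \<subseteq> K"
    and Lo: "Lo \<subseteq> K" "\<And>\<rho> \<tau>. \<tau> \<in> Lo \<Longrightarrow> (\<rho>, \<tau>) \<in> le \<Longrightarrow> \<rho> \<in> Lo"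
  shows "bit_fun.span (restricted_column Up R ` Lo) =
    bit_fun.span (restricted_column Up boundary_matrix ` Lo)"
proof -
  let ?D = "restricted_column Up boundary_matrix" and ?R = "restricted_column Up R"
  note leD = linear_extensionD[OF le]
  have U: "\<And>\<tau>. \<tau> \<in> K \<Longrightarrow> U \<tau> \<tau> = 1" "\<And>\<rho> \<tau>. \<rho> \<in> K \<Longrightarrow> \<tau> \<in> K \<Longrightarrow> U \<rho> \<tau> \<noteq> 0 \<Longrightarrow> (\<rho>, \<tau>) \<in> le"
    and R: "\<And>\<sigma> \<tau>. \<sigma> \<in> K \<Longrightarrow> \<tau> \<in> K \<Longrightarrow> R \<sigma> \<tau> = (\<Sum>\<rho>\<in>K. boundary_matrix \<sigma> \<rho> * U \<rho> \<tau>)"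
    using dec unfolding persistence_decomposition_def unit_upper_triangular_def by auto
  have finLo: "finite Lo" using Lo(1) fin finite_subset by blast
  have eq: "?R \<tau> = (\<Sum>\<rho>\<in>Lo. bit_scale (U \<rho> \<tau>) (?D \<rho>))" if "\<tau> \<in> Lo" for \<tau>
  proof
    fix \<sigma>
    show "?R \<tau> \<sigma> = (\<Sum>\<rho>\<in>Lo. bit_scale (U \<rho> \<tau>) (?D \<rho>)) \<sigma>"
    proof (cases "\<sigma> \<in> Up")
      case True
      have "(\<Sum>\<rho>\<in>K. boundary_matrix \<sigma> \<rho> * U \<rho> \<tau>) = (\<Sum>\<rho>\<in>Lo. boundary_matrix \<sigma> \<rho> * U \<rho> \<tau>)"
      proof (rule sum.mono_neutral_right[OF fin Lo(1)], rule ballI)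
        fix \<rho> assume "\<rho> \<in> K - Lo"
        then have "U \<rho> \<tau> = 0" using U(2)[of \<rho> \<tau>] Lo that by blast
        then show "boundary_matrix \<sigma> \<rho> * U \<rho> \<tau> = 0" by (simp only: mult_zero_right)
      qed
      moreover have "R \<sigma> \<tau> = (\<Sum>\<rho>\<in>K. boundary_matrix \<sigma> \<rho> * U \<rho> \<tau>)"
        using R True Up Lo(1) that by blast
      ultimately show ?thesis
        using True by (simp only: fun_sum_apply bit_scale_def restricted_column_def if_True mult.commute)
    qed (auto simp: fun_sum_apply bit_scale_def restricted_column_def)
  qed
  have sub: "?R ` Lo \<subseteq> bit_fun.span (?D ` Lo)"
    by (auto simp: eq intro!: bit_fun.span_sum intro: bit_fun.span_scale bit_fun.span_base)
  have "?D \<tau> \<in> bit_fun.span (?R ` Lo)" if "\<tau> \<in> Lo" for \<tau>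
    using that
  \<comment> \<open>The number of predecessors is the position of \<tau> in the order, so this is
    induction along the columns from left to right.\<close>
  proof (induction "card {\<rho>. (\<rho>, \<tau>) \<in> le}" arbitrary: \<tau> rule: less_induct)
    case less
    have IH: "?D \<rho> \<in> bit_fun.span (?R ` Lo)" if "\<rho> \<in> Lo" "\<rho> \<noteq> \<tau>" "(\<rho>, \<tau>) \<in> le" for \<rho>
    proof (rule less(1))
      have "finite {\<rho>. (\<rho>, \<tau>) \<in> le}" by (rule finite_subset[OF _ fin]) (use leD(1) in blast)
      moreover have "{\<rho>'. (\<rho>', \<rho>) \<in> le} \<subset> {\<rho>. (\<rho>, \<tau>) \<in> le}"
        using that leD by blast
      ultimately show "card {\<rho>'. (\<rho>', \<rho>) \<in> le} < card {\<rho>. (\<rho>, \<tau>) \<in> le}"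
        by (rule psubset_card_mono)
    qed (use that in auto)
    have "?R \<tau> = ?D \<tau> + (\<Sum>\<rho>\<in>Lo - {\<tau>}. bit_scale (U \<rho> \<tau>) (?D \<rho>))"
    proof -
      have "U \<tau> \<tau> = 1" using U(1) Lo(1) less(2) by blast
      then show ?thesis
        by (simp add: eq[OF less(2)] sum.remove[OF finLo less(2), of "\<lambda>\<rho>. bit_scale (U \<rho> \<tau>) (?D \<rho>)"])
    qed
    \<comment> \<open>The diagonal entry 1 isolates the boundary column; every other term with
      nonzero coefficient is an earlier column, covered by \<open>IH\<close>.\<close>
    then have D: "?D \<tau> = ?R \<tau> - (\<Sum>\<rho>\<in>Lo - {\<tau>}. bit_scale (U \<rho> \<tau>) (?D \<rho>))"
      by (simp add: algebra_simps)
    have "bit_scale (U \<rho> \<tau>) (?D \<rho>) \<in> bit_fun.span (?R ` Lo)" if "\<rho> \<in> Lo - {\<tau>}" for \<rho>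
    proof (cases "U \<rho> \<tau> = 0")
      case True
      then show ?thesis by (simp add: bit_fun.span_zero)
    next
      case False
      then show ?thesis
        using IH[of \<rho>] U(2)[of \<rho> \<tau>] that less(2) Lo(1) by (auto intro: bit_fun.span_scale)
    qed
    then show ?case
      unfolding D using less(2)
      by (intro bit_fun.span_diff bit_fun.span_sum) (auto intro: bit_fun.span_base)
  qed
  then have "?D ` Lo \<subseteq> bit_fun.span (?R ` Lo)" by auto
  with sub show ?thesis by (intro bit_fun.span_eq[THEN iffD2] conjI)
qed

text \<open>By the preceding lemma the rank can be computed from \<open>R\<close>. A truncated
  column of \<open>R\<close> vanishes unless its lowest entry lies in \<open>Up\<close>, and the
  remaining columns have distinct lowest entries, hence are independent as in an echelon form. They
  correspond to the counted pairs, while the rank refers to the order only through \<open>Up\<close>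
  and \<open>Lo\<close>.\<close>

lemma card_pairs_eq_rank:
  assumes fin: "finite K" and le: "linear_extension K le"
    and dec: "persistence_decomposition K le R U"
    and Up: "Up \<subseteq> K" "\<And>\<sigma> \<rho>. \<sigma> \<in> Up \<Longrightarrow> (\<sigma>, \<rho>) \<in> le \<Longrightarrow> \<rho> \<in> Up"
    and Lo: "Lo \<subseteq> K" "\<And>\<rho> \<tau>. \<tau> \<in> Lo \<Longrightarrow> (\<rho>, \<tau>) \<in> le \<Longrightarrow> \<rho> \<in> Lo"
  shows "card (birth_death_pairs K le R \<inter> Up \<times> Lo) =
    bit_fun.dim (restricted_column Up boundary_matrix ` Lo)"
proof -
  let ?R = "restricted_column Up R"
  let ?P = "birth_death_pairs K le R \<inter> Up \<times> Lo"
  note leD = linear_extensionD[OF le]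
  define T where "T = snd ` ?P"
  have low_unique: "\<sigma> = \<sigma>'" if "is_low K le R \<sigma> \<tau>" "is_low K le R \<sigma>' \<tau>" for \<sigma> \<sigma>' \<tau>
    using that leD(4) unfolding is_low_def by blast
  have red: "\<tau> = \<tau>'" if "is_low K le R \<sigma> \<tau>" "is_low K le R \<sigma> \<tau>'" for \<sigma> \<tau> \<tau>'
    using that dec unfolding persistence_decomposition_def reduced_def is_low_def by blast
  have T: "\<tau> \<in> T \<longleftrightarrow> \<tau> \<in> Lo \<and> (\<exists>\<sigma>\<in>Up. is_low K le R \<sigma> \<tau>)" for \<tau>
    unfolding T_def birth_death_pairs_def by force
  have finT: "finite T"
    using T Lo(1) fin by (meson finite_subset subsetI)
  define low where "low \<tau> = (SOME \<sigma>. is_low K le R \<sigma> \<tau>)" for \<tau>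
  have low: "is_low K le R (low \<tau>) \<tau>" "low \<tau> \<in> Up" if "\<tau> \<in> T" for \<tau>
    using that T low_unique unfolding low_def by (metis someI)+
  \<comment> \<open>A nonzero entry in a row of \<open>Up\<close> is followed, or equalled, by the
    lowest one, which is then in the up-closed set \<open>Up\<close> too.\<close>
  have zero: "?R \<tau> = 0" if "\<tau> \<in> Lo - T" for \<tau>
  proof (rule ccontr)
    assume "?R \<tau> \<noteq> 0"
    then obtain \<sigma> where s: "\<sigma> \<in> Up" "R \<sigma> \<tau> \<noteq> 0"
      by (auto simp: restricted_column_def fun_eq_iff split: if_splits)
    obtain \<rho> where r: "\<rho> \<in> {\<rho>\<in>K. R \<rho> \<tau> \<noteq> 0}" "\<And>x. x \<in> {\<rho>\<in>K. R \<rho> \<tau> \<noteq> 0} \<Longrightarrow> (x, \<rho>) \<in> le"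
      by (rule linear_extension_has_max[OF _ _ _ le, of "{\<rho>\<in>K. R \<rho> \<tau> \<noteq> 0}"]) (use fin s Up in auto)
    then have "is_low K le R \<rho> \<tau>" using that Lo(1) by (auto simp: is_low_def)
    moreover have "\<rho> \<in> Up" using r s Up by blast
    ultimately show False using that T by blast
  qed
  have indep: "c \<tau> = 0" if sum: "(\<Sum>\<tau>\<in>T. bit_scale (c \<tau>) (?R \<tau>)) = 0" and "\<tau> \<in> T" for c \<tau>
  proof (rule ccontr)
    assume "c \<tau> \<noteq> 0"
    let ?S = "low ` {\<tau>\<in>T. c \<tau> \<noteq> 0}"
    \<comment> \<open>Take the last row \<sigma> among the lowest entries of the columns with
      nonzero coefficient. Only one of these columns reaches row \<sigma>, so the sum has a nonzero
      entry there.\<close>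
    obtain \<sigma> where s: "\<sigma> \<in> ?S" "\<And>x. x \<in> ?S \<Longrightarrow> (x, \<sigma>) \<in> le"
      by (rule linear_extension_has_max[OF _ _ _ le, of ?S])
        (use finT \<open>c \<tau> \<noteq> 0\<close> \<open>\<tau> \<in> T\<close> low Up in auto)
    then obtain \<tau>' where t: "\<tau>' \<in> T" "c \<tau>' \<noteq> 0" "\<sigma> = low \<tau>'" by auto
    have "c \<rho> * ?R \<rho> \<sigma> = 0" if "\<rho> \<in> T - {\<tau>'}" for \<rho>
    proof (rule ccontr)
      assume nz: "c \<rho> * ?R \<rho> \<sigma> \<noteq> 0"
      then have "R \<sigma> \<rho> \<noteq> 0" "c \<rho> \<noteq> 0" by (auto simp: restricted_column_def split: if_splits)
      then have "(\<sigma>, low \<rho>) \<in> le" "(low \<rho>, \<sigma>) \<in> le"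
        using that low[of \<rho>] s(2) low[OF t(1)] t(3) unfolding is_low_def by auto
      then have "low \<rho> = \<sigma>" using leD(4) by blast
      then show False using red low(1)[of \<rho>] low(1)[OF t(1)] that t by auto
    qed
    then have "(\<Sum>\<tau>\<in>T - {\<tau>'}. c \<tau> * ?R \<tau> \<sigma>) = 0" by (intro sum.neutral ballI)
    then have "(\<Sum>\<tau>\<in>T. c \<tau> * ?R \<tau> \<sigma>) = c \<tau>' * ?R \<tau>' \<sigma>"
      by (simp only: sum.remove[OF finT t(1), of "\<lambda>\<tau>. c \<tau> * ?R \<tau> \<sigma>"] add_0_right)
    moreover have "c \<tau>' * ?R \<tau>' \<sigma> \<noteq> 0"
      using t low[OF t(1)] by (auto simp: restricted_column_def is_low_def)
    ultimately show False using fun_cong[OF sum, of \<sigma>] by (simp add: fun_sum_apply bit_scale_def)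
  qed
  have inj: "inj_on ?R T"
  proof (rule inj_onI, rule ccontr)
    fix \<tau> \<tau>' assume *: "\<tau> \<in> T" "\<tau>' \<in> T" "?R \<tau> = ?R \<tau>'" "\<tau> \<noteq> \<tau>'"
    \<comment> \<open>With coefficients 1, two equal columns cancel in characteristic two, which
      contradicts \<open>indep\<close>. Injectivity makes the set of columns as large as
      \<open>T\<close>.\<close>
    let ?c = "\<lambda>x. if x = \<tau> \<or> x = \<tau>' then 1 else 0 :: bit"
    have "(\<Sum>\<tau>\<in>T. bit_scale (?c \<tau>) (?R \<tau>)) = (\<Sum>\<tau>\<in>{\<tau>, \<tau>'}. bit_scale (?c \<tau>) (?R \<tau>))"
      by (rule sum.mono_neutral_right) (use * finT in auto)
    also have "\<dots> = 0" using * by (simp add: fun_eq_iff bit_scale_def)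
    finally show False using indep[of ?c \<tau>] * by auto
  qed
  have "bit_fun.independent (?R ` T)"
  proof (rule bit_fun.independent_if_scalars_zero)
    fix f x assume "(\<Sum>x\<in>?R ` T. bit_scale (f x) x) = 0" "x \<in> ?R ` T"
    then show "f x = 0" using indep[of "\<lambda>\<tau>. f (?R \<tau>)"] by (auto simp: sum.reindex[OF inj])
  qed (use finT in auto)
  moreover have "bit_fun.span (?R ` Lo) = bit_fun.span (?R ` T)"
  proof -
    have "?R ` T \<subseteq> bit_fun.span (?R ` Lo)" using T by (blast intro: bit_fun.span_base)
    moreover have "?R \<tau> \<in> bit_fun.span (?R ` T)" if "\<tau> \<in> Lo" for \<tau>
    proof (cases "\<tau> \<in> T")
      case True
      then show ?thesis by (blast intro: bit_fun.span_base)
    next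
      case False
      then show ?thesis
        using zero[of \<tau>] that bit_fun.span_zero[of "?R ` T"] by (metis DiffI)
    qed
    ultimately show ?thesis
      by (intro bit_fun.span_eq[THEN iffD2] conjI image_subsetI) blast+
  qed
  then have "bit_fun.span (?R ` T) = bit_fun.span (restricted_column Up boundary_matrix ` Lo)"
    using span_reduced_columns[OF fin le dec Up(1) Lo] by (rule trans[OF sym])
  ultimately have "bit_fun.dim (restricted_column Up boundary_matrix ` Lo) = card (?R ` T)"
    by (intro bit_fun.dim_eq_card)
  also have "\<dots> = card T" by (rule card_image[OF inj])
  also have "\<dots> = card ?P"
    unfolding T_def by (rule card_image) (auto simp: inj_on_def birth_death_pairs_def dest: low_unique)
  finally show ?thesis by simp
qed

text \<open>The pairs at exactly \<open>(a, b)\<close> are obtained by inclusion-exclusion from four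
  quadrants, with strict or weak inequality at each of \<open>a\<close> and \<open>b\<close>. The
  super- and sublevel sets of \<open>w\<close> are up- and down-closed for both orders, so each
  quadrant count is a rank of the same submatrix of the boundary matrix.\<close>

lemma card_level_pairs_eq:
  assumes fin: "finite K"
    and le: "linear_extension K le" "order_preserving le w" "persistence_decomposition K le R U"
    and le': "linear_extension K le'" "order_preserving le' w" "persistence_decomposition K le' R' U'"
  shows "card {(\<sigma>, \<tau>) \<in> birth_death_pairs K le R. w \<sigma> = a \<and> w \<tau> = b} =
    card {(\<sigma>, \<tau>) \<in> birth_death_pairs K le' R'. w \<sigma> = a \<and> w \<tau> = b}"
proof -
  define N where "N le R Up Lo = card (birth_death_pairs K le R \<inter> Up \<times> Lo)" for le R Up Lo
  let ?U = "{\<sigma>\<in>K. w \<sigma> \<ge> a}" and ?U' = "{\<sigma>\<in>K. w \<sigma> > a}"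
  let ?L = "{\<sigma>\<in>K. w \<sigma> \<le> b}" and ?L' = "{\<sigma>\<in>K. w \<sigma> < b}"
  \<comment> \<open>Inclusion-exclusion in additive form, which avoids truncated subtraction of
    natural numbers.\<close>
  have key: "card {(\<sigma>, \<tau>) \<in> birth_death_pairs K le R. w \<sigma> = a \<and> w \<tau> = b} + N le R ?U' ?L + N le R ?U ?L'
     = N le R ?U ?L + N le R ?U' ?L'" for le R
  proof -
    let ?B = "birth_death_pairs K le R"
    have sub: "?B \<subseteq> K \<times> K" by (auto simp: birth_death_pairs_def is_low_def)
    then have finB: "finite ?B" using fin finite_subset by blast
    define E where "E = {(\<sigma>, \<tau>) \<in> ?B. w \<sigma> = a \<and> w \<tau> = b}"
    have E: "finite E" using finB unfolding E_def by (rule rev_finite_subset) auto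
    have "?B \<inter> ?U \<times> ?L = E \<union> (?B \<inter> ?U' \<times> ?L \<union> ?B \<inter> ?U \<times> ?L')"
      using sub by (auto simp: E_def)
    moreover have "E \<inter> (?B \<inter> ?U' \<times> ?L \<union> ?B \<inter> ?U \<times> ?L') = {}" by (auto simp: E_def)
    ultimately have "N le R ?U ?L = card E + card (?B \<inter> ?U' \<times> ?L \<union> ?B \<inter> ?U \<times> ?L')"
      unfolding N_def using finB E by (simp add: card_Un_disjoint)
    moreover have "(?B \<inter> ?U' \<times> ?L) \<inter> (?B \<inter> ?U \<times> ?L') = ?B \<inter> ?U' \<times> ?L'" by auto
    ultimately show ?thesis
      using card_Un_Int[of "?B \<inter> ?U' \<times> ?L" "?B \<inter> ?U \<times> ?L'"] finB
      unfolding N_def E_def[symmetric] by simp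
  qed
  have N: "N le R Up Lo = N le' R' Up Lo"
    if "Up = ?U \<or> Up = ?U'" "Lo = ?L \<or> Lo = ?L'" for Up Lo
  proof -
    have "N le R Up Lo = bit_fun.dim (restricted_column Up boundary_matrix ` Lo)"
      if "linear_extension K le" "order_preserving le w" "persistence_decomposition K le R U"
        "Up = ?U \<or> Up = ?U'" "Lo = ?L \<or> Lo = ?L'" for le R U
      unfolding N_def
    proof (rule card_pairs_eq_rank[OF fin that(1,3)])
      have mono: "w \<sigma> \<le> w \<tau> \<and> \<sigma> \<in> K \<and> \<tau> \<in> K" if "(\<sigma>, \<tau>) \<in> le" for \<sigma> \<tau>
        using \<open>order_preserving le w\<close> linear_extensionD(1)[OF \<open>linear_extension K le\<close>] that
        unfolding order_preserving_def by blast
      show "Up \<subseteq> K" "Lo \<subseteq> K" using that(4,5) by auto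
      show "\<rho> \<in> Up" if "\<sigma> \<in> Up" "(\<sigma>, \<rho>) \<in> le" for \<sigma> \<rho>
        using mono[OF that(2)] that(1) \<open>Up = ?U \<or> Up = ?U'\<close> by auto
      show "\<rho> \<in> Lo" if "\<tau> \<in> Lo" "(\<rho>, \<tau>) \<in> le" for \<rho> \<tau>
        using mono[OF that(2)] that(1) \<open>Lo = ?L \<or> Lo = ?L'\<close> by auto
    qed
    from this[OF le that] this[OF le' that] show ?thesis by simp
  qed
  show ?thesis using key[of le R] key[of le' R'] N by simp
qed

lemma diagram_independent:
  assumes fin: "finite K"
    and "linear_extension K le" "order_preserving le w" "persistence_decomposition K le R U"
    and "linear_extension K le'" "order_preserving le' w" "persistence_decomposition K le' R' U'"
  shows "image_mset (\<lambda>(\<sigma>, \<tau>). (w \<sigma>, w \<tau>)) (mset_set (birth_death_pairs K le R)) =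
    image_mset (\<lambda>(\<sigma>, \<tau>). (w \<sigma>, w \<tau>)) (mset_set (birth_death_pairs K le' R'))"
proof (rule multiset_eqI, clarify)
  fix a b
  have "count (image_mset (\<lambda>(\<sigma>, \<tau>). (w \<sigma>, w \<tau>)) (mset_set (birth_death_pairs K le R))) (a, b) =
     card {(\<sigma>, \<tau>) \<in> birth_death_pairs K le R. w \<sigma> = a \<and> w \<tau> = b}" for le R
  proof -
    have "finite (birth_death_pairs K le R)"
      by (rule finite_subset[of _ "K \<times> K"]) (use fin in \<open>auto simp: birth_death_pairs_def is_low_def\<close>)
    then have "count (image_mset (\<lambda>(\<sigma>, \<tau>). (w \<sigma>, w \<tau>)) (mset_set (birth_death_pairs K le R))) (a, b) =
      card {x \<in> birth_death_pairs K le R. (a, b) = (\<lambda>(\<sigma>, \<tau>). (w \<sigma>, w \<tau>)) x}"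
      by (simp add: count_image_mset')
    also have "{x \<in> birth_death_pairs K le R. (a, b) = (\<lambda>(\<sigma>, \<tau>). (w \<sigma>, w \<tau>)) x} =
        {(\<sigma>, \<tau>) \<in> birth_death_pairs K le R. w \<sigma> = a \<and> w \<tau> = b}" by auto
    finally show ?thesis .
  qed
  then show "count (image_mset (\<lambda>(\<sigma>, \<tau>). (w \<sigma>, w \<tau>)) (mset_set (birth_death_pairs K le R))) (a, b) =
    count (image_mset (\<lambda>(\<sigma>, \<tau>). (w \<sigma>, w \<tau>)) (mset_set (birth_death_pairs K le' R'))) (a, b)"
    using card_level_pairs_eq[OF assms] by simp
qed

lemma weight_order_extension:
  assumes tri: "linear_extension K tri" and w: "w \<in> weights K"
  shows "linear_extension K (weight_order K tri w)" "order_preserving (weight_order K tri w) w"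
proof -
  note triD = linear_extensionD[OF tri]
  have "refl_on K (weight_order K tri w)"
    using triD(2) by (auto simp: refl_on_def weight_order_def)
  moreover have "trans (weight_order K tri w)"
    using triD(3) by (auto simp: trans_def weight_order_def)
  moreover have "antisym (weight_order K tri w)"
    using triD(4) by (auto simp: antisym_def weight_order_def)
  moreover have "total_on K (weight_order K tri w)"
    using triD(5) by (auto simp: total_on_def weight_order_def)
  moreover have "(\<sigma>, \<tau>) \<in> weight_order K tri w" if "\<sigma> \<in> K" "\<tau> \<in> K" "\<sigma> \<subseteq> \<tau>" for \<sigma> \<tau>
    using that tri w by (auto simp: weight_order_def weights_def linear_extension_def less_le)
  ultimately show "linear_extension K (weight_order K tri w)"
    by (auto simp: linear_extension_def linear_order_on_def partial_order_on_def preorder_on_def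
        weight_order_def)
  show "order_preserving (weight_order K tri w) w"
    by (auto simp: order_preserving_def weight_order_def)
qed

text \<open>The order of the weight with the output of the algorithm is one admissible choice in
  \<open>weight_diagram\<close>, and by \<open>diagram_independent\<close> all admissible choices
  give the same multiset, so \<open>SOME\<close> must return it.\<close>

lemma forget_labels_labeled_weight_diagram:
  assumes fin: "finite K" and alg: "persistence_algorithm K alg"
    and tri: "linear_extension K tri" and w: "w \<in> weights K"
  shows "forget_labels (labeled_weight_diagram K alg tri kind w) = weight_diagram K w"
proof -
  let ?le = "weight_order K tri w"
  let ?a = "image_mset (\<lambda>(\<sigma>, \<tau>). (w \<sigma>, w \<tau>)) (mset_set (birth_death_pairs K ?le (fst (alg ?le))))"
  have dec: "persistence_decomposition K ?le (fst (alg ?le)) (snd (alg ?le))"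
    using alg weight_order_extension[OF tri w] by (auto simp: persistence_algorithm_def)
  have "weight_diagram K w = ?a"
    unfolding weight_diagram_def
    by (rule some_equality)
      (use weight_order_extension[OF tri w] dec diagram_independent[OF fin] in blast)+
  then show ?thesis
    unfolding forget_labels_def labeled_weight_diagram_def
    by (simp add: Let_def multiset.map_comp comp_def case_prod_unfold)
qed

section \<open>Norming functionals, uniqueness of Pettis integrals and their behaviour under linear
  maps\<close>

section \<open>Pettis integrals in finite powers of a Banach space\<close>

text \<open>One-dimensional Hahn-Banach extension, with partial functionals represented by their
  graphs as subspaces of a product. The value \<open>c\<close> at \<open>z\<close> must lie between
  all \<open>r - norm (x - z)\<close> and all \<open>norm (x + z) - r\<close>; by the triangle
  inequality no lower bound exceeds an upper one.\<close>

lemma norm_dominated_extension_step: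
  fixes G :: "('b::real_normed_vector \<times> real) set"
  assumes G: "subspace G" and dom: "\<And>x r. (x, r) \<in> G \<Longrightarrow> r \<le> norm x"
  obtains G' c where "subspace G'" "\<And>x r. (x, r) \<in> G' \<Longrightarrow> r \<le> norm x" "G \<subseteq> G'" "(z, c) \<in> G'"
proof -
  let ?S = "(\<lambda>(x, r). norm (x + z) - r) ` G"
  have lower: "r' - norm (y - z) \<le> norm (x + z) - r" if "(x, r) \<in> G" "(y, r') \<in> G" for x r y r'
  proof -
    have "r + r' \<le> norm (x + y)" using dom subspace_add[OF G that] by simp
    also have "\<dots> \<le> norm (x + z) + norm (y - z)"
      using norm_triangle_ineq[of "x + z" "y - z"] by simp
    finally show ?thesis by simp
  qed
  define c where "c = Inf ?S"
  have 0: "(0, 0) \<in> G" using subspace_0[OF G] by (simp add: zero_prod_def)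
  have ne: "?S \<noteq> {}" using 0 by auto
  have bdd: "bdd_below ?S"
    using lower[OF _ 0] by (intro bdd_belowI[of _ "- norm (0 - z)"]) auto
  have c1: "c \<le> norm (x + z) - r" if "(x, r) \<in> G" for x r
    unfolding c_def by (rule cInf_lower[OF _ bdd]) (use that in force)
  have c2: "r - norm (x - z) \<le> c" if "(x, r) \<in> G" for x r
    unfolding c_def by (rule cInf_greatest[OF ne]) (use lower that in auto)
  define G' where "G' = span (insert (z, c) G)"
  show thesis
  proof
    show "subspace G'" by (simp add: G'_def)
    show "G \<subseteq> G'" "(z, c) \<in> G'" by (auto simp: G'_def intro: span_base)
    fix x r assume "(x, r) \<in> G'"
    then obtain k where "(x, r) - k *\<^sub>R (z, c) \<in> G"
      unfolding G'_def span_insert using span_eq_iff[THEN iffD2, OF G] by auto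
    then have k: "(x - k *\<^sub>R z, r - k * c) \<in> G" by simp
    \<comment> \<open>Dividing by the absolute value of \<open>k\<close> reduces a positive multiple
      of \<open>z\<close> to the upper bound \<open>c1\<close> and a negative one to the lower bound
      \<open>c2\<close>.\<close>
    consider "k = 0" | "k > 0" | "k < 0" by linarith
    then show "r \<le> norm x"
    proof cases
      case 1
      then show ?thesis using k dom by simp
    next
      case 2
      have "(1 / k) *\<^sub>R (x - k *\<^sub>R z, r - k * c) \<in> G" by (rule subspace_scale[OF G k])
      then have "((1 / k) *\<^sub>R x - z, r / k - c) \<in> G" using 2 by (simp add: algebra_simps diff_divide_distrib)
      from c1[OF this] have "r / k \<le> norm ((1 / k) *\<^sub>R x)" by simp
      then show ?thesis using 2 by (simp add: divide_le_cancel)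
    next
      case 3
      have "(- 1 / k) *\<^sub>R (x - k *\<^sub>R z, r - k * c) \<in> G" by (rule subspace_scale[OF G k])
      then have "((- 1 / k) *\<^sub>R x + z, - r / k + c) \<in> G" using 3 by (simp add: algebra_simps diff_divide_distrib)
      from c2[OF this] have "- r / k \<le> norm ((- 1 / k) *\<^sub>R x)" by simp
      then show ?thesis using 3 by (simp add: field_simps)
    qed
  qed
qed

text \<open>Zorn's lemma for the dominated graphs through \<open>(x0, norm x0)\<close>: by the
  extension step a maximal one is defined everywhere.\<close>

lemma Hahn_Banach_norming_functional:
  fixes x0 :: "'b::real_normed_vector"
  obtains \<phi> where "bounded_linear \<phi>" "\<phi> x0 = norm x0"
proof -
  define \<G> where "\<G> = {G :: ('b \<times> real) set. subspace G \<and> (\<forall>(x, r)\<in>G. r \<le> norm x) \<and> (x0, norm x0) \<in> G}"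
  have "span {(x0, norm x0)} \<in> \<G>"
    unfolding \<G>_def mem_Collect_eq
  proof (intro conjI subspace_span)
    show "\<forall>(x, r)\<in>span {(x0, norm x0)}. r \<le> norm x"
      by (auto simp: span_singleton mult_right_mono)
    show "(x0, norm x0) \<in> span {(x0, norm x0)}" by (rule span_base) simp
  qed
  then have ne: "\<G> \<noteq> {}" by auto
  have ch: "\<Union>\<C> \<in> \<G>" if ne: "\<C> \<noteq> {}" and ch: "subset.chain \<G> \<C>" for \<C>
  proof -
    have sub: "\<C> \<subseteq> \<G>" and tot: "\<And>X Y. X \<in> \<C> \<Longrightarrow> Y \<in> \<C> \<Longrightarrow> X \<subseteq> Y \<or> Y \<subseteq> X"
      using ch by (auto simp: subset.chain_def)
    have sp: "\<And>X. X \<in> \<C> \<Longrightarrow> subspace X" using sub by (auto simp: \<G>_def)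
    have "subspace (\<Union>\<C>)"
    proof (rule subspaceI)
      show "0 \<in> \<Union>\<C>" using ne sp subspace_0 by blast
      show "x + y \<in> \<Union>\<C>" if "x \<in> \<Union>\<C>" "y \<in> \<Union>\<C>" for x y
      proof -
        obtain X Y where XY: "X \<in> \<C>" "Y \<in> \<C>" "x \<in> X" "y \<in> Y"
          using \<open>x \<in> \<Union>\<C>\<close> \<open>y \<in> \<Union>\<C>\<close> by blast
        then consider "x \<in> Y" | "y \<in> X" using tot by blast
        then show ?thesis using XY sp by cases (blast intro: subspace_add)+
      qed
      show "k *\<^sub>R x \<in> \<Union>\<C>" if "x \<in> \<Union>\<C>" for k x
        using that sp subspace_scale by blast
    qed
    then show ?thesis using sub ne unfolding \<G>_def by blast
  qed
  obtain G where G: "G \<in> \<G>" and max: "\<And>X. X \<in> \<G> \<Longrightarrow> G \<subseteq> X \<Longrightarrow> X = G"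
    using subset_Zorn_nonempty[OF ne ch] by blast
  have sp: "subspace G" and dom: "\<And>x r. (x, r) \<in> G \<Longrightarrow> r \<le> norm x" and x0: "(x0, norm x0) \<in> G"
    using G by (auto simp: \<G>_def)
  have tot: "\<exists>c. (z, c) \<in> G" for z
  proof -
    obtain G' c where *: "subspace G'" "\<And>x r. (x, r) \<in> G' \<Longrightarrow> r \<le> norm x" "G \<subseteq> G'" "(z, c) \<in> G'"
      using norm_dominated_extension_step[OF sp dom] by blast
    then have "G' \<in> \<G>" using x0 by (auto simp: \<G>_def)
    with * max show ?thesis by blast
  qed
  \<comment> \<open>Domination already forces the graph to be single-valued: both
    \<open>(0, r - r')\<close> and its negative lie in \<open>G\<close>, and the norm of 0 is
    0.\<close>
  have uniq: "r = r'" if "(x, r) \<in> G" "(x, r') \<in> G" for x r r'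
    using dom[of 0 "r - r'"] dom[of 0 "r' - r"] subspace_diff[OF sp that] subspace_diff[OF sp that(2,1)] by simp
  define \<phi> where "\<phi> z = (THE c. (z, c) \<in> G)" for z
  have eq: "\<phi> z = c" if "(z, c) \<in> G" for z c
    unfolding \<phi>_def using that uniq by blast
  have mem: "(z, \<phi> z) \<in> G" for z using tot eq by metis
  have "bounded_linear \<phi>"
  proof (rule bounded_linear_intro[where K = 1])
    show "\<phi> (x + y) = \<phi> x + \<phi> y" for x y
      using eq subspace_add[OF sp mem[of x] mem[of y]] by simp
    show "\<phi> (r *\<^sub>R x) = r *\<^sub>R \<phi> x" for r x
      using eq subspace_scale[OF sp mem[of x], of r] by simp
    show "norm (\<phi> x) \<le> norm x * 1" for x
      using dom[OF mem, of x] dom[OF subspace_neg[OF sp mem[of x], simplified]] by simp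
  qed
  with eq[OF x0] that show thesis by blast
qed

text \<open>A functional that norms the difference of two integrals takes equal values at both, so
  the difference has norm 0.\<close>

lemma has_pettis_integral_unique:
  fixes f :: "'w \<Rightarrow> 'b::real_normed_vector"
  assumes "has_pettis_integral UNIV dual_space M f e" "has_pettis_integral UNIV dual_space M f e'"
  shows "e = e'"
proof -
  obtain \<phi> where phi: "bounded_linear \<phi>" "\<phi> (e - e') = norm (e - e')"
    by (rule Hahn_Banach_norming_functional)
  then have "\<phi> e = \<phi> e'" using assms by (auto simp: has_pettis_integral_def dual_space_def)
  then show ?thesis using phi linear_diff[OF bounded_linear.linear[OF phi(1)], of e e'] by simp
qed

lemma pettis_expectation_eq:
  "has_pettis_integral UNIV dual_space M f e \<Longrightarrow> pettis_expectation M f = e"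
  unfolding pettis_expectation_def using has_pettis_integral_unique by blast

lemma coordinate_functional_in_power_dual:
  assumes "finite S" "s \<in> S" "bounded_linear \<phi>"
  shows "(\<lambda>x. \<phi> (x s)) \<in> power_dual S"
proof -
  interpret \<phi>: bounded_linear \<phi> by fact
  obtain C where C: "C > 0" "\<And>x. norm (\<phi> x) \<le> norm x * C" using \<phi>.pos_bounded by blast
  have "\<bar>\<phi> (x s)\<bar> \<le> C * (\<Sum>s\<in>S. norm (x s))" for x
  proof -
    have "norm (x s) \<le> (\<Sum>s\<in>S. norm (x s))" using assms by (intro member_le_sum) auto
    then show ?thesis using C(1) C(2)[of "x s"]
      by (smt (verit) mult.commute mult_left_mono real_norm_def)
  qed
  then show ?thesis by (auto simp: power_dual_def \<phi>.add \<phi>.scale)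
qed

lemma power_has_pettis_integral_coordinate:
  fixes f :: "'w \<Rightarrow> 's \<Rightarrow> 'b::real_normed_vector"
  assumes "has_pettis_integral (S \<rightarrow>\<^sub>E UNIV) (power_dual S) M f e" "finite S" "s \<in> S"
  shows "has_pettis_integral UNIV dual_space M (\<lambda>\<omega>. f \<omega> s) (e s)"
  unfolding has_pettis_integral_def
proof (intro conjI ballI)
  fix \<phi> :: "'b \<Rightarrow> real" assume "\<phi> \<in> dual_space"
  then have "(\<lambda>x. \<phi> (x s)) \<in> power_dual S"
    using coordinate_functional_in_power_dual[OF assms(2,3)] by (simp add: dual_space_def)
  then have "integrable M (\<lambda>\<omega>. (\<lambda>x. \<phi> (x s)) (f \<omega>)) \<and>
      (\<integral>\<omega>. (\<lambda>x. \<phi> (x s)) (f \<omega>) \<partial>M) = (\<lambda>x. \<phi> (x s)) e"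
    using assms(1)[unfolded has_pettis_integral_def, THEN conjunct2] by (rule bspec[rotated])
  then show "integrable M (\<lambda>\<omega>. \<phi> (f \<omega> s))" "(\<integral>\<omega>. \<phi> (f \<omega> s) \<partial>M) = \<phi> (e s)" by simp_all
qed simp

lemma power_pettis_expectation_eq:
  assumes "has_pettis_integral (S \<rightarrow>\<^sub>E UNIV) (power_dual S) M f e" "finite S"
  shows "power_pettis_expectation S M f = e"
  unfolding power_pettis_expectation_def
proof (rule the_equality)
  fix e' assume e': "has_pettis_integral (S \<rightarrow>\<^sub>E UNIV) (power_dual S) M f e'"
  show "e' = e"
  \<comment> \<open>Both candidates take the default value outside \<open>S\<close>, so uniqueness
    may be checked in each coordinate.\<close>
  proof (rule PiE_ext)
    show "e' \<in> S \<rightarrow>\<^sub>E UNIV" "e \<in> S \<rightarrow>\<^sub>E UNIV" using assms e' by (auto simp: has_pettis_integral_def)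
    show "e' s = e s" if "s \<in> S" for s
      by (rule has_pettis_integral_unique)
        (use power_has_pettis_integral_coordinate[OF _ assms(2) that] assms e' in auto)
  qed
qed (rule assms)

lemma has_pettis_integral_sum:
  fixes f :: "'s \<Rightarrow> 'w \<Rightarrow> 'b::real_normed_vector"
  assumes "\<And>s. s \<in> S \<Longrightarrow> has_pettis_integral UNIV dual_space M (f s) (e s)"
  shows "has_pettis_integral UNIV dual_space M (\<lambda>\<omega>. \<Sum>s\<in>S. f s \<omega>) (\<Sum>s\<in>S. e s)"
  unfolding has_pettis_integral_def
proof (intro conjI ballI)
  fix \<phi> :: "'b \<Rightarrow> real" assume phi: "\<phi> \<in> dual_space"
  then interpret \<phi>: bounded_linear \<phi> by (simp add: dual_space_def)
  have "integrable M (\<lambda>\<omega>. \<phi> (f s \<omega>))" "(\<integral>\<omega>. \<phi> (f s \<omega>) \<partial>M) = \<phi> (e s)" if "s \<in> S" for s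
    using assms[OF that] phi by (auto simp: has_pettis_integral_def)
  then show "integrable M (\<lambda>\<omega>. \<phi> (\<Sum>s\<in>S. f s \<omega>))"
    "(\<integral>\<omega>. \<phi> (\<Sum>s\<in>S. f s \<omega>) \<partial>M) = \<phi> (\<Sum>s\<in>S. e s)"
    by (simp_all add: \<phi>.sum)
qed auto

text \<open>An integral in the power yields one in every coordinate, and their sum is an integral of
  \<open>g\<close>. By uniqueness both definite descriptions denote these vectors.\<close>

lemma pettis_expectation_sum_coordinates:
  fixes f :: "'w \<Rightarrow> 's \<Rightarrow> 'b::real_normed_vector"
  assumes "finite S" "power_pettis_expectation_exists S M f" "\<And>\<omega>. (\<Sum>s\<in>S. f \<omega> s) = g \<omega>"
  shows "pettis_expectation M g = (\<Sum>s\<in>S. power_pettis_expectation S M f s)"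
proof -
  obtain e where e: "has_pettis_integral (S \<rightarrow>\<^sub>E UNIV) (power_dual S) M f e"
    using assms(2) by (auto simp: power_pettis_expectation_exists_def)
  have "has_pettis_integral UNIV dual_space M (\<lambda>\<omega>. \<Sum>s\<in>S. f \<omega> s) (\<Sum>s\<in>S. e s)"
    by (intro has_pettis_integral_sum power_has_pettis_integral_coordinate[OF e assms(1)])
  then show ?thesis
    using power_pettis_expectation_eq[OF e assms(1)] pettis_expectation_eq assms(3) by simp
qed

text \<open>The norm bound, applied to the difference, has only zero summands over \<open>S\<close>.
  Functionals therefore do not see the default values outside \<open>S\<close>.\<close>

lemma power_dual_cong:
  assumes "\<phi> \<in> power_dual S" "\<And>s. s \<in> S \<Longrightarrow> x s = y s"
  shows "\<phi> x = \<phi> y"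
proof -
  obtain C where C: "\<And>x. \<bar>\<phi> x\<bar> \<le> C * (\<Sum>s\<in>S. norm (x s))"
    using assms(1) by (auto simp: power_dual_def)
  have "\<phi> (\<lambda>s. x s + (-1) *\<^sub>R y s) = \<phi> x - \<phi> y"
  proof -
    have add: "\<phi> (\<lambda>s. x s + y s) = \<phi> x + \<phi> y" and scale: "\<phi> (\<lambda>s. k *\<^sub>R x s) = k * \<phi> x" for x y k
      using assms(1) unfolding power_dual_def by blast+
    show ?thesis using add[of x "\<lambda>s. (-1) *\<^sub>R y s"] scale[of "-1" y] by simp
  qed
  moreover have "\<bar>\<phi> (\<lambda>s. x s + (-1) *\<^sub>R y s)\<bar> \<le> 0"
    using C[of "\<lambda>s. x s + (-1) *\<^sub>R y s"] assms(2) by simp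
  ultimately show ?thesis by simp
qed

text \<open>A real matrix acts as a bounded linear map between the powers. It pulls functionals on
  the \<open>T\<close>-power back to functionals on the \<open>S\<close>-power, so it carries an
  integral of \<open>f\<close> to one of the image.\<close>

lemma power_pettis_expectation_exists_matrix:
  fixes f :: "'w \<Rightarrow> 's \<Rightarrow> 'b::real_normed_vector" and r :: "'t \<Rightarrow> 's \<Rightarrow> real"
  assumes fin: "finite S" "finite T" and "power_pettis_expectation_exists S M f"
  shows "power_pettis_expectation_exists T M (\<lambda>\<omega>. \<lambda>t\<in>T. \<Sum>s\<in>S. r t s *\<^sub>R f \<omega> s)"
proof -
  obtain e where e: "has_pettis_integral (S \<rightarrow>\<^sub>E UNIV) (power_dual S) M f e"
    using assms(3) by (auto simp: power_pettis_expectation_exists_def)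
  define L where "L x t = (\<Sum>s\<in>S. r t s *\<^sub>R x s)" for x :: "'s \<Rightarrow> 'b" and t
  have "has_pettis_integral (T \<rightarrow>\<^sub>E UNIV) (power_dual T) M (\<lambda>\<omega>. \<lambda>t\<in>T. L (f \<omega>) t) (\<lambda>t\<in>T. L e t)"
    unfolding has_pettis_integral_def
  proof (intro conjI ballI)
    fix \<phi> :: "('t \<Rightarrow> 'b) \<Rightarrow> real" assume phi: "\<phi> \<in> power_dual T"
    have restr: "\<phi> (restrict x T) = \<phi> x" for x by (rule power_dual_cong[OF phi]) auto
    obtain C where C: "\<And>x. \<bar>\<phi> x\<bar> \<le> C * (\<Sum>s\<in>T. norm (x s))"
      using phi by (auto simp: power_dual_def)
    have lin: "\<phi> (\<lambda>s. x s + y s) = \<phi> x + \<phi> y" "\<phi> (\<lambda>s. k *\<^sub>R x s) = k * \<phi> x" for x y k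
      using phi unfolding power_dual_def by blast+
    have "(\<lambda>x. \<phi> (L x)) \<in> power_dual S"
      unfolding power_dual_def
    proof (intro CollectI conjI allI)
      fix x y :: "'s \<Rightarrow> 'b"
      have "L (\<lambda>s. x s + y s) = (\<lambda>t. L x t + L y t)"
        by (auto simp: L_def fun_eq_iff scaleR_add_right sum.distrib)
      then show "\<phi> (L (\<lambda>s. x s + y s)) = \<phi> (L x) + \<phi> (L y)" by (simp only: lin)
    next
      fix k and x :: "'s \<Rightarrow> 'b"
      have "L (\<lambda>s. k *\<^sub>R x s) = (\<lambda>t. k *\<^sub>R L x t)"
        by (auto simp: L_def fun_eq_iff scaleR_sum_right mult.commute)
      then show "\<phi> (L (\<lambda>s. k *\<^sub>R x s)) = k * \<phi> (L x)" by (simp only: lin)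
    next
      \<comment> \<open>The sum of the absolute values of all entries bounds the operator norm for
        the sum norms.\<close>
      define R where "R = (\<Sum>t\<in>T. \<Sum>s\<in>S. \<bar>r t s\<bar>)"
      have "\<bar>\<phi> (L x)\<bar> \<le> \<bar>C\<bar> * R * (\<Sum>s\<in>S. norm (x s))" for x
      proof -
        have "(\<Sum>t\<in>T. norm (L x t)) \<le> (\<Sum>t\<in>T. \<Sum>s\<in>S. \<bar>r t s\<bar> * (\<Sum>s\<in>S. norm (x s)))"
          unfolding L_def
          by (intro sum_mono order.trans[OF norm_sum])
            (auto intro!: mult_left_mono member_le_sum fin)
        then have "(\<Sum>t\<in>T. norm (L x t)) \<le> R * (\<Sum>s\<in>S. norm (x s))"
          by (simp add: R_def sum_distrib_right)
        moreover have "\<bar>\<phi> (L x)\<bar> \<le> \<bar>C\<bar> * (\<Sum>t\<in>T. norm (L x t))"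
          by (rule order.trans[OF C]) (auto intro!: mult_right_mono sum_nonneg)
        ultimately show ?thesis
          by (smt (verit) abs_ge_zero mult.assoc mult_left_mono)
      qed
      then show "\<exists>C. \<forall>x. \<bar>\<phi> (L x)\<bar> \<le> C * (\<Sum>s\<in>S. norm (x s))" by blast
    qed
    then show "integrable M (\<lambda>\<omega>. \<phi> (\<lambda>t\<in>T. L (f \<omega>) t))"
      "(\<integral>\<omega>. \<phi> (\<lambda>t\<in>T. L (f \<omega>) t) \<partial>M) = \<phi> (\<lambda>t\<in>T. L e t)"
      using e unfolding has_pettis_integral_def restr by auto
  qed auto
  then show ?thesis unfolding power_pettis_expectation_exists_def L_def by blast
qed

section \<open>Lebesgue measure on affine subspaces and partitions into cubes\<close>

section \<open>Relative volume\<close>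

text \<open>The map along which \<open>flat_measure\<close> transports Lebesgue measure; for
  orthonormal \<open>B\<close> it is an isometry onto its image.\<close>

definition flat_chart :: "'a::euclidean_space \<Rightarrow> 'a set \<Rightarrow> ('a \<Rightarrow> real) \<Rightarrow> 'a" where
  "flat_chart a B f = a + (\<Sum>b\<in>B. f b *\<^sub>R b)"

text \<open>The direction space of an affine set has an orthonormal basis, so the choices made by
  \<open>SOME\<close> in \<open>flat_measure\<close> have the intended properties.\<close>

lemma flat_measure_chart:
  fixes H :: "'a::euclidean_space set"
  assumes "affine H" "H \<noteq> {}"
  obtains a B where "a \<in> H" "pairwise orthogonal B" "\<And>b. b \<in> B \<Longrightarrow> norm b = 1" "finite B"
    "span B = (\<lambda>x. x - a) ` H" "flat_measure H = distr (\<Pi>\<^sub>M b\<in>B. lborel) borel (flat_chart a B)"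
proof -
  define a where "a = (SOME a. a \<in> H)"
  define B where
    "B = (SOME B. pairwise orthogonal B \<and> (\<forall>b\<in>B. norm b = 1) \<and> span B = (\<lambda>x. x - a) ` H)"
  have a: "a \<in> H" unfolding a_def using assms(2) by (simp add: some_in_eq)
  have "subspace ((\<lambda>x. x - a) ` H)"
    using affine_diffs_subspace_subtract[OF assms(1) a] by simp
  then obtain B0 where "pairwise orthogonal B0" "\<And>x. x \<in> B0 \<Longrightarrow> norm x = 1" "span B0 = (\<lambda>x. x - a) ` H"
    by (rule orthonormal_basis_subspace) blast
  then have "\<exists>B. pairwise orthogonal B \<and> (\<forall>b\<in>B. norm b = 1) \<and> span B = (\<lambda>x. x - a) ` H" by blast
  from someI_ex[OF this] have B: "pairwise orthogonal B" "\<And>b. b \<in> B \<Longrightarrow> norm b = 1" "span B = (\<lambda>x. x - a) ` H"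
    unfolding B_def by blast+
  have "independent B" by (rule pairwise_orthogonal_independent) (use B in force)+
  then have "finite B" by (rule independent_imp_finite)
  moreover have "flat_measure H = distr (\<Pi>\<^sub>M b\<in>B. lborel) borel (flat_chart a B)"
    unfolding flat_measure_def Let_def a_def[symmetric] B_def[symmetric] flat_chart_def ..
  ultimately show thesis using that a B by blast
qed

lemma flat_chart_measurable [measurable]:
  "flat_chart a B \<in> (\<Pi>\<^sub>M b\<in>B. lborel) \<rightarrow>\<^sub>M borel"
  unfolding flat_chart_def by measurable

lemma inner_flat_chart:
  assumes "pairwise orthogonal B" "\<And>b. b \<in> B \<Longrightarrow> norm b = 1" "finite B" "b \<in> B"
  shows "(flat_chart a B f - a) \<bullet> b = f b"
proof -
  have "(flat_chart a B f - a) \<bullet> b = (\<Sum>c\<in>B. f c * (c \<bullet> b))"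
    by (simp add: flat_chart_def inner_sum_left)
  also have "\<dots> = (\<Sum>c\<in>B. if c = b then f b else 0)"
    using assms(1,2,4) by (intro sum.cong) (auto simp: pairwise_def orthogonal_def norm_eq_1)
  finally show ?thesis using assms by simp
qed

text \<open>In coordinates, boundedness puts \<open>P\<close> inside a box and a relative interior
  point puts a box of positive width inside \<open>P\<close>. For a single point \<open>B\<close> is
  empty and the box volumes are the empty product 1.\<close>

lemma flat_measure_convex_body:
  fixes P :: "'a::euclidean_space set"
  assumes P: "compact P" "convex P" "P \<noteq> {}"
  shows "sets (flat_measure (affine hull P)) = sets borel"
    and "emeasure (flat_measure (affine hull P)) P < \<infinity>"
    and "emeasure (flat_measure (affine hull P)) P > 0"
proof -
  let ?H = "affine hull P"
  obtain a B where a: "a \<in> ?H" and orth: "pairwise orthogonal B" and one: "\<And>b. b \<in> B \<Longrightarrow> norm b = 1"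
    and fin: "finite B" and span: "span B = (\<lambda>x. x - a) ` ?H"
    and eq: "flat_measure ?H = distr (\<Pi>\<^sub>M b\<in>B. lborel) borel (flat_chart a B)"
    by (rule flat_measure_chart[of ?H]) (use P in auto)
  interpret product_sigma_finite "\<lambda>b::'a. lborel :: real measure" by standard
  let ?\<Pi> = "\<Pi>\<^sub>M b\<in>B. (lborel :: real measure)"
  have chart_span: "flat_chart a B f \<in> ?H" for f
  proof -
    have "(\<Sum>b\<in>B. f b *\<^sub>R b) \<in> span B" by (intro span_sum span_scale span_base)
    then show ?thesis unfolding span flat_chart_def by (auto simp: image_iff)
  qed
  have box: "emeasure ?\<Pi> (\<Pi>\<^sub>E b\<in>B. {l b..u b}) = (\<Prod>b\<in>B. ennreal (u b - l b))"
    if "\<And>b. b \<in> B \<Longrightarrow> l b \<le> u b" for l u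
    using that fin by (subst emeasure_PiM) (auto intro!: prod.cong)
  have [measurable]: "P \<in> sets borel" using P(1) by (intro borel_closed compact_imp_closed)
  show "sets (flat_measure ?H) = sets borel" by (simp add: eq)
  have em: "emeasure (flat_measure ?H) P = emeasure ?\<Pi> (flat_chart a B -` P \<inter> space ?\<Pi>)"
    unfolding eq by (rule emeasure_distr) auto
  show "emeasure (flat_measure ?H) P < \<infinity>"
  proof -
    obtain r where r: "\<And>x. x \<in> P \<Longrightarrow> norm (x - a) \<le> r"
      using compact_imp_bounded[OF P(1)] unfolding bounded_any_center[of P a]
      by (metis dist_norm norm_minus_commute)
    have "flat_chart a B -` P \<inter> space ?\<Pi> \<subseteq> (\<Pi>\<^sub>E b\<in>B. {- \<bar>r\<bar>..\<bar>r\<bar>})"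
    proof (intro subsetI PiE_I)
      fix f b assume f: "f \<in> flat_chart a B -` P \<inter> space ?\<Pi>" and b: "b \<in> B"
      \<comment> \<open>A coordinate is the inner product with a unit vector, so Cauchy-Schwarz
        bounds it.\<close>
      have "\<bar>f b\<bar> \<le> norm (flat_chart a B f - a)"
        using Cauchy_Schwarz_ineq2[of "flat_chart a B f - a" b] inner_flat_chart[OF orth one fin b] one[OF b]
        by simp
      also have "\<dots> \<le> r" using r f by auto
      finally show "f b \<in> {- \<bar>r\<bar>..\<bar>r\<bar>}" by auto
    qed (auto simp: space_PiM)
    then have "emeasure (flat_measure ?H) P \<le> emeasure ?\<Pi> (\<Pi>\<^sub>E b\<in>B. {- \<bar>r\<bar>..\<bar>r\<bar>})"
      unfolding em using fin by (intro emeasure_mono) auto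
    also have "\<dots> < \<infinity>" by (subst box) (auto simp: power_less_top_ennreal)
    finally show ?thesis .
  qed
  show "emeasure (flat_measure ?H) P > 0"
  proof -
    obtain p where "p \<in> rel_interior P" using P rel_interior_eq_empty by blast
    then obtain e where e: "e > 0" "cball p e \<inter> ?H \<subseteq> P" and p: "p \<in> P"
      by (auto simp: mem_rel_interior_cball)
    define q where "q b = (p - a) \<bullet> b" for b
    \<comment> \<open>Each of the \<open>card B\<close> coordinates moves the point by at most
      \<open>h\<close>, in total by at most \<open>e\<close>; the added 1 keeps the denominator
      positive when \<open>B\<close> is empty.\<close>
    define h where "h = e / (1 + real (card B))"
    have h: "h > 0" "real (card B) * h \<le> e"
      using e by (auto simp: h_def field_simps)
    have "p - a \<in> span B" unfolding span using hull_inc[OF p, of affine] by (rule imageI)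
    have pq: "p = flat_chart a B q"
    proof -
      obtain f where "p - a = (\<Sum>b\<in>B. f b *\<^sub>R b)"
        using \<open>p - a \<in> span B\<close> span_finite[OF fin] by auto
      then have pf: "p = flat_chart a B f" by (simp add: flat_chart_def algebra_simps)
      have "q b = f b" if "b \<in> B" for b
        unfolding q_def by (subst pf) (rule inner_flat_chart[OF orth one fin that])
      then show ?thesis unfolding pf flat_chart_def by (auto intro!: sum.cong)
    qed
    have "(\<Pi>\<^sub>E b\<in>B. {q b - h..q b + h}) \<subseteq> flat_chart a B -` P \<inter> space ?\<Pi>"
    proof
      fix f assume f: "f \<in> (\<Pi>\<^sub>E b\<in>B. {q b - h..q b + h})"
      have "flat_chart a B f - p = (\<Sum>b\<in>B. (f b - q b) *\<^sub>R b)"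
        by (subst pq) (simp add: flat_chart_def scaleR_diff_left sum_subtractf)
      also have "norm \<dots> \<le> (\<Sum>b\<in>B. h)"
      proof (intro order.trans[OF norm_sum] sum_mono)
        fix b assume b: "b \<in> B"
        then have "f b \<in> {q b - h..q b + h}" using f by auto
        then show "norm ((f b - q b) *\<^sub>R b) \<le> h" by (auto simp: one[OF b] abs_le_iff)
      qed
      finally have "flat_chart a B f \<in> cball p e" using h by (simp add: dist_norm norm_minus_commute)
      then show "f \<in> flat_chart a B -` P \<inter> space ?\<Pi>"
        using e chart_span[of f] f by (auto simp: space_PiM)
    qed
    then have "emeasure ?\<Pi> (\<Pi>\<^sub>E b\<in>B. {q b - h..q b + h}) \<le> emeasure (flat_measure ?H) P"
      unfolding em by (intro emeasure_mono) auto
    moreover have "emeasure ?\<Pi> (\<Pi>\<^sub>E b\<in>B. {q b - h..q b + h}) > 0"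
      using h fin by (subst box) (auto simp: zero_less_iff_neq_zero)
    ultimately show ?thesis by simp
  qed
qed

lemma sum_rel_volume_pieces:
  fixes P :: "'a::euclidean_space set"
  assumes P: "compact P" "convex P" "P \<noteq> {}"
    and C: "finite C" "disjoint C" "\<And>c. c \<in> C \<Longrightarrow> c \<in> sets borel" "P \<subseteq> \<Union>C"
  shows "(\<Sum>c\<in>C. rel_volume P (P \<inter> c) / rel_volume P P) = 1"
proof -
  note body = flat_measure_convex_body[OF P]
  let ?\<mu> = "flat_measure (affine hull P)"
  have sP: "P \<in> sets borel" using P(1) by (intro borel_closed compact_imp_closed)
  have "(\<Sum>c\<in>C. measure ?\<mu> (P \<inter> c)) = measure ?\<mu> (\<Union>c\<in>C. P \<inter> c)"
  proof (rule measure_finite_Union[symmetric])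
    show "(\<lambda>c. P \<inter> c) ` C \<subseteq> sets ?\<mu>" using body(1) C sP by auto
    show "disjoint_family_on (\<lambda>c. P \<inter> c) C"
      using C(2) by (auto simp: disjoint_family_on_def disjoint_def)
    show "emeasure ?\<mu> (P \<inter> c) \<noteq> \<infinity>" if "c \<in> C" for c
      using body(2) emeasure_mono[of "P \<inter> c" P ?\<mu>] body(1) sP by (auto simp: less_top[symmetric] top_unique)
  qed (use C in auto)
  also have "(\<Union>c\<in>C. P \<inter> c) = P" using C(4) by auto
  finally have "(\<Sum>c\<in>C. rel_volume P (P \<inter> c)) = rel_volume P P" by (simp add: rel_volume_def)
  \<comment> \<open>Finiteness matters as much as positivity here, because \<open>measure\<close>
    turns an infinite value into 0.\<close>
  moreover have "rel_volume P P \<noteq> 0"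
    using body(2,3) by (auto simp: rel_volume_def measure_def enn2real_eq_0_iff)
  ultimately show ?thesis by (simp flip: sum_divide_distrib)
qed

lemma half_open_cube_borel: "(\<lambda>x. t + x) ` half_open_cube s \<in> sets borel"
proof -
  have "(\<lambda>x. t + x) ` half_open_cube s = {x. \<forall>i. t $ i \<le> x $ i \<and> x $ i < t $ i + s}"
  proof (intro set_eqI iffI)
    fix x assume "x \<in> {x. \<forall>i. t $ i \<le> x $ i \<and> x $ i < t $ i + s}"
    then show "x \<in> (\<lambda>x. t + x) ` half_open_cube s"
      by (intro image_eqI[of _ _ "x - t"]) (auto simp: half_open_cube_def diff_less_eq add.commute)
  qed (auto simp: half_open_cube_def)
  also have "\<dots> \<in> sets borel" by measurable
  finally show ?thesis .
qed

text \<open>The cubes of a partition may be shifted against each other, so there is no common grid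
  to count. Instead a cube is encoded by the integer parts of its corner divided by
  \<open>s\<close>: disjointness makes the code injective, and boundedness of \<open>T\<close>
  leaves finitely many codes.\<close>

lemma finite_cubes_meeting_bounded:
  fixes Q :: "(real ^ 'd) set set"
  assumes Q: "cube_partition s Q" and bdd: "bounded T"
  shows "finite {c \<in> Q. c \<inter> T \<noteq> {}}"
proof -
  have s: "s > 0" and dis: "disjoint Q" and cubes: "\<And>c. c \<in> Q \<Longrightarrow> \<exists>t. c = (\<lambda>x. t + x) ` half_open_cube s"
    using Q by (auto simp: cube_partition_def partition_on_def)
  define corner where "corner c = (SOME t. c = (\<lambda>x. t + x) ` half_open_cube s)" for c :: "(real ^ 'd) set"
  have corner: "c = (\<lambda>x. corner c + x) ` half_open_cube s" if "c \<in> Q" for c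
    unfolding corner_def by (rule someI_ex[OF cubes[OF that]])
  have mem: "x \<in> c \<longleftrightarrow> (\<forall>i. corner c $ i \<le> x $ i \<and> x $ i < corner c $ i + s)" if "c \<in> Q" for c x
    by (subst corner[OF that])
      (auto simp: half_open_cube_def image_iff diff_less_eq add.commute intro!: exI[of _ "x - corner c"])
  obtain r where r: "\<And>x. x \<in> T \<Longrightarrow> norm x \<le> r" using bdd by (auto simp: bounded_iff)
  define N where "N = \<lceil>(\<bar>r\<bar> + s) / s\<rceil>"
  define idx where "idx c = (\<lambda>i. \<lfloor>corner c $ i / s\<rfloor>)" for c
  have "inj_on idx Q"
  proof (rule inj_onI)
    fix c c' assume c: "c \<in> Q" "c' \<in> Q" "idx c = idx c'"
    have "\<bar>corner c $ i - corner c' $ i\<bar> < s" for i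
    proof -
      have "\<bar>corner c $ i / s - corner c' $ i / s\<bar> < 1"
        using fun_cong[OF c(3), of i] unfolding idx_def by linarith
      then show ?thesis using s by (simp add: abs_divide field_simps flip: diff_divide_distrib)
    qed
    \<comment> \<open>If the corners differ by less than \<open>s\<close> in every coordinate, their
      coordinatewise maximum lies in both half-open cubes.\<close>
    then have "(\<chi> i. max (corner c $ i) (corner c' $ i)) \<in> c \<inter> c'"
      using c(1,2) s by (auto simp: mem abs_less_iff max_def) (smt (verit))+
    then show "c = c'" using c dis by (auto simp: disjoint_def)
  qed
  moreover have "idx ` {c \<in> Q. c \<inter> T \<noteq> {}} \<subseteq> (UNIV \<rightarrow>\<^sub>E {- N - 1..N})"
  proof (intro subsetI, elim imageE, simp only:, intro PiE_I)
    fix c i assume "c \<in> {c \<in> Q. c \<inter> T \<noteq> {}}"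
    then obtain x where c: "c \<in> Q" "x \<in> c" "x \<in> T" by blast
    have "\<bar>x $ i\<bar> \<le> r" using r[OF c(3)] component_le_norm_cart[of x i] by linarith
    then have "\<bar>corner c $ i\<bar> \<le> \<bar>r\<bar> + s" using mem[OF c(1)] c(2) s by (smt (verit))
    then have "\<bar>corner c $ i / s\<bar> \<le> (\<bar>r\<bar> + s) / s" using s by (simp add: divide_right_mono)
    then show "idx c i \<in> {- N - 1..N}" unfolding idx_def N_def atLeastAtMost_iff by linarith
  qed auto
  moreover have "finite ((UNIV :: 'd set) \<rightarrow>\<^sub>E {- N - 1..N})" by (intro finite_PiE) auto
  ultimately have "finite (idx ` {c \<in> Q. c \<inter> T \<noteq> {}})" "inj_on idx {c \<in> Q. c \<inter> T \<noteq> {}}"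
    by (blast intro: finite_subset, blast intro: inj_on_subset)
  then show ?thesis by (rule finite_imageD)
qed

section \<open>Double counting over simplices, chains and voxels\<close>

section \<open>Sums of coordinates\<close>

text \<open>After exchanging the sums, a nonzero chain contributes one share of
  \<open>1 / card \<gamma>\<close> for each of its simplices. The zero chain occurs in no
  coordinate, which is why its component has to vanish.\<close>

lemma sum_simplex_distribution:
  fixes Fhat :: "'v chain \<Rightarrow> 'v labeled_diagram \<Rightarrow> 'b::real_normed_vector"
  assumes fin: "finite K" and zero: "Fhat {} a = 0"
  shows "(\<Sum>\<sigma>\<in>K. simplex_distribution K Fhat a \<sigma>) = (\<Sum>\<gamma>\<in>chains K. Fhat \<gamma> a)"
proof -
  have finC: "finite (chains K)" using fin by (simp add: chains_def)
  have "(\<Sum>\<sigma>\<in>K. simplex_distribution K Fhat a \<sigma>) =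
      (\<Sum>\<sigma>\<in>K. \<Sum>\<gamma> | \<gamma> \<in> chains K \<and> \<sigma> \<in> \<gamma>. Fhat \<gamma> a /\<^sub>R real (card \<gamma>))"
    by (simp add: simplex_distribution_def)
  also have "\<dots> = (\<Sum>\<gamma>\<in>chains K. \<Sum>\<sigma> | \<sigma> \<in> K \<and> \<sigma> \<in> \<gamma>. Fhat \<gamma> a /\<^sub>R real (card \<gamma>))"
    by (rule sum.swap_restrict[OF fin finC])
  also have "\<dots> = (\<Sum>\<gamma>\<in>chains K. Fhat \<gamma> a)"
  proof (rule sum.cong[OF refl])
    fix \<gamma> assume "\<gamma> \<in> chains K"
    then have "\<gamma> \<subseteq> K" by (simp add: chains_def)
    then have "{\<sigma>. \<sigma> \<in> K \<and> \<sigma> \<in> \<gamma>} = \<gamma>" "finite \<gamma>" using fin finite_subset by auto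
    then show "(\<Sum>\<sigma> | \<sigma> \<in> K \<and> \<sigma> \<in> \<gamma>. Fhat \<gamma> a /\<^sub>R real (card \<gamma>)) = Fhat \<gamma> a"
      using zero by (cases "\<gamma> = {}") (simp_all add: sum_constant_scaleR)
  qed
  finally show ?thesis .
qed

lemma realization_convex_body:
  assumes "finite_simplicial_complex V K" "\<sigma> \<in> K"
  shows "compact (realization v \<sigma>)" "convex (realization v \<sigma>)" "realization v \<sigma> \<noteq> {}"
proof -
  have "finite \<sigma>" "\<sigma> \<noteq> {}"
    using assms finite_subset by (auto simp: finite_simplicial_complex_def)
  then show "compact (realization v \<sigma>)" "convex (realization v \<sigma>)" "realization v \<sigma> \<noteq> {}"
    unfolding realization_def by (auto intro!: finite_imp_compact_convex_hull)
qed

lemma finite_voxels: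
  assumes "finite_simplicial_complex V K" "cube_partition s Q"
  shows "finite (voxels K v Q)"
proof -
  have "bounded (\<Union>\<sigma>\<in>K. realization v \<sigma>)"
    using finite_complex[OF assms(1)] realization_convex_body[OF assms(1)]
    by (intro bounded_UN) (auto intro: compact_imp_bounded)
  then show ?thesis unfolding voxels_def by (rule finite_cubes_meeting_bounded[OF assms(2)])
qed

text \<open>After exchanging the sums, the coefficient of each simplex is the total of its volume
  fractions, which is 1 because the voxels cover its realization disjointly.\<close>

lemma sum_voxel_distribution:
  assumes K: "finite_simplicial_complex V K" and Q: "cube_partition s Q"
  shows "(\<Sum>c\<in>voxels K v Q. voxel_distribution K v Q Fhat a c) =
    (\<Sum>\<sigma>\<in>K. simplex_distribution K Fhat a \<sigma>)"
proof -
  let ?C = "voxels K v Q"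
  let ?r = "\<lambda>\<sigma> c. rel_volume (realization v \<sigma>) (realization v \<sigma> \<inter> c) /
    rel_volume (realization v \<sigma>) (realization v \<sigma>)"
  have part: "partition_on UNIV Q" and cubes: "\<And>c. c \<in> Q \<Longrightarrow> \<exists>t. c = (\<lambda>x. t + x) ` half_open_cube s"
    using Q by (auto simp: cube_partition_def)
  have "(\<Sum>c\<in>?C. voxel_distribution K v Q Fhat a c) =
      (\<Sum>c\<in>?C. \<Sum>\<sigma>\<in>K. ?r \<sigma> c *\<^sub>R simplex_distribution K Fhat a \<sigma>)"
    by (simp add: voxel_distribution_def)
  also have "\<dots> = (\<Sum>\<sigma>\<in>K. (\<Sum>c\<in>?C. ?r \<sigma> c) *\<^sub>R simplex_distribution K Fhat a \<sigma>)"
    by (subst sum.swap) (simp add: scaleR_sum_left)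
  also have "\<dots> = (\<Sum>\<sigma>\<in>K. simplex_distribution K Fhat a \<sigma>)"
  proof (rule sum.cong[OF refl])
    fix \<sigma> assume \<sigma>: "\<sigma> \<in> K"
    have "(\<Sum>c\<in>?C. ?r \<sigma> c) = 1"
    proof (rule sum_rel_volume_pieces[OF realization_convex_body[OF K \<sigma>] finite_voxels[OF K Q]])
      show "disjoint ?C"
        using partition_onD2[OF part] by (auto simp: voxels_def disjoint_def)
      show "c \<in> sets borel" if "c \<in> ?C" for c
        using that cubes[of c] half_open_cube_borel by (auto simp: voxels_def)
      show "realization v \<sigma> \<subseteq> \<Union>?C"
        using partition_onD1[OF part] \<sigma> unfolding voxels_def by blast
    qed
    then show "(\<Sum>c\<in>?C. ?r \<sigma> c) *\<^sub>R simplex_distribution K Fhat a \<sigma> = simplex_distribution K Fhat a \<sigma>"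
      by simp
  qed
  finally show ?thesis .
qed

text \<open>An integral of a sum does not give integrals of the summands, so each equation is
  conditional on the existence of its coordinate expectation; the third conjunct passes existence
  from simplices to voxels.\<close>

theorem theorem5p6:
  fixes V :: "'v set" and K :: "'v set set" and v :: "'v \<Rightarrow> real ^ 'd"
    and alg :: "'v set rel \<Rightarrow> 'v matrix \<times> 'v matrix"
    and tri :: "'v set rel" and kind :: label_kind
    and A :: "(real ^ 'm) set" and \<psi> :: "real ^ 'm \<Rightarrow> 'v set \<Rightarrow> real"
    and F :: "diagram \<Rightarrow> 'b::{banach, second_countable_topology}"
    and Fhat :: "'v chain \<Rightarrow> 'v labeled_diagram \<Rightarrow> 'b"
    and s :: real and Q :: "(real ^ 'd) set set"
    and M :: "'w measure" and X :: "'w \<Rightarrow> real ^ 'm"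
  defines "\<alpha> \<equiv> param_diagram K A \<psi>"
    and "\<alpha>hat \<equiv> param_labeled_diagram K alg tri kind A \<psi>"
    and "C \<equiv> voxels K v Q"
  defines "\<eta>K \<equiv> \<lambda>p. simplex_distribution K Fhat (\<alpha>hat p)"
    and "\<eta>C \<equiv> \<lambda>p. voxel_distribution K v Q Fhat (\<alpha>hat p)"
  assumes "finite_simplicial_complex V K"
    and "persistence_algorithm K alg"
    and "linear_extension K tri"
    and "\<psi> ` A \<subseteq> weights K"
    and "labeled_decomposition K (labeled_diagrams K alg tri kind) F Fhat"
    and zero_chain: "\<forall>a\<in>labeled_diagrams K alg tri kind. Fhat {} a = 0"
    and "cube_partition s Q"
    and "\<eta>K \<in> borel \<rightarrow>\<^sub>M (\<Pi>\<^sub>M \<sigma>\<in>K. borel)"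
    and "\<eta>C \<in> borel \<rightarrow>\<^sub>M (\<Pi>\<^sub>M c\<in>C. borel)"
    and "prob_space M"
    and "X \<in> M \<rightarrow>\<^sub>M borel"
    and "pettis_expectation_exists M (\<lambda>\<omega>. F (\<alpha> (X \<omega>)))"
  shows "(power_pettis_expectation_exists K M (\<lambda>\<omega>. \<eta>K (X \<omega>)) \<longrightarrow>
            pettis_expectation M (\<lambda>\<omega>. F (\<alpha> (X \<omega>))) =
              (\<Sum>\<sigma>\<in>K. power_pettis_expectation K M (\<lambda>\<omega>. \<eta>K (X \<omega>)) \<sigma>)) \<and>
         (power_pettis_expectation_exists C M (\<lambda>\<omega>. \<eta>C (X \<omega>)) \<longrightarrow>
            pettis_expectation M (\<lambda>\<omega>. F (\<alpha> (X \<omega>))) =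
              (\<Sum>c\<in>C. power_pettis_expectation C M (\<lambda>\<omega>. \<eta>C (X \<omega>)) c)) \<and>
         (power_pettis_expectation_exists K M (\<lambda>\<omega>. \<eta>K (X \<omega>)) \<longrightarrow>
            power_pettis_expectation_exists C M (\<lambda>\<omega>. \<eta>C (X \<omega>)))"
proof -
  have K: "finite K" by (rule finite_complex) fact
  have C: "finite C"
    unfolding C_def by (rule finite_voxels) fact+
  have mem: "\<alpha>hat p \<in> labeled_diagrams K alg tri kind" for p
    using \<open>\<psi> ` A \<subseteq> weights K\<close>
    by (auto simp: \<alpha>hat_def param_labeled_diagram_def labeled_diagrams_def)
  \<comment> \<open>On \<open>A\<close> this is the independence result for weights; off
    \<open>A\<close> both diagrams are empty.\<close>
  have forget: "forget_labels (\<alpha>hat p) = \<alpha> p" for p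
  proof (cases "p \<in> A")
    case True
    then have "\<psi> p \<in> weights K" using \<open>\<psi> ` A \<subseteq> weights K\<close> by blast
    then show ?thesis
      using True forget_labels_labeled_weight_diagram[OF K \<open>persistence_algorithm K alg\<close>
          \<open>linear_extension K tri\<close>]
      by (simp add: \<alpha>hat_def \<alpha>_def param_labeled_diagram_def param_diagram_def)
  qed (simp add: \<alpha>hat_def \<alpha>_def param_labeled_diagram_def param_diagram_def forget_labels_def)
  have sumK: "(\<Sum>\<sigma>\<in>K. \<eta>K p \<sigma>) = F (\<alpha> p)" for p
  proof -
    have "(\<Sum>\<sigma>\<in>K. \<eta>K p \<sigma>) = (\<Sum>\<gamma>\<in>chains K. Fhat \<gamma> (\<alpha>hat p))"
      unfolding \<eta>K_def by (rule sum_simplex_distribution[OF K]) (use zero_chain mem in blast)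
    then show ?thesis
      using \<open>labeled_decomposition K _ F Fhat\<close> mem forget by (simp add: labeled_decomposition_def)
  qed
  have sumC: "(\<Sum>c\<in>C. \<eta>C p c) = F (\<alpha> p)" for p
    using sum_voxel_distribution[OF \<open>finite_simplicial_complex V K\<close> \<open>cube_partition s Q\<close>,
        of v Fhat "\<alpha>hat p"] sumK[of p]
    by (simp add: \<eta>C_def \<eta>K_def C_def)
  show ?thesis
  proof (intro conjI impI)
    assume "power_pettis_expectation_exists K M (\<lambda>\<omega>. \<eta>K (X \<omega>))"
    from pettis_expectation_sum_coordinates[OF K this sumK]
    show "pettis_expectation M (\<lambda>\<omega>. F (\<alpha> (X \<omega>))) =
      (\<Sum>\<sigma>\<in>K. power_pettis_expectation K M (\<lambda>\<omega>. \<eta>K (X \<omega>)) \<sigma>)" .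
  next
    assume "power_pettis_expectation_exists C M (\<lambda>\<omega>. \<eta>C (X \<omega>))"
    from pettis_expectation_sum_coordinates[OF C this sumC]
    show "pettis_expectation M (\<lambda>\<omega>. F (\<alpha> (X \<omega>))) =
      (\<Sum>c\<in>C. power_pettis_expectation C M (\<lambda>\<omega>. \<eta>C (X \<omega>)) c)" .
  next
    assume "power_pettis_expectation_exists K M (\<lambda>\<omega>. \<eta>K (X \<omega>))"
    \<comment> \<open>\<open>\<eta>C\<close> is the matrix of volume fractions applied to
      \<open>\<eta>K\<close>.\<close>
    from power_pettis_expectation_exists_matrix[OF K C this]
    show "power_pettis_expectation_exists C M (\<lambda>\<omega>. \<eta>C (X \<omega>))"
      unfolding \<eta>C_def \<eta>K_def voxel_distribution_def C_def .
  qed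
qed

end
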